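(* Let $q_->q_+>0$ and $\beta>0$ be real numbers, and let $\beta_{\rm c}:=\frac12\left(\sqrt{q_-}-\sqrt{q_+}\right)^2$. Consider the branching particle system on $\mathbb{R}$ with parameters $(q_+,q_-,\beta)$ described in the context, started at time $0$ with exactly one particle, of type $+$, at position $0$. (a) Suppose that $\beta>\beta_{\rm c}$. Then, with probability $1$, each of infinitely many particles will spend time to the left of $0$ (i.e. infinitely many particles are at a strictly negative position at some time during their lives). (b) Suppose instead that $\beta\le\beta_{\rm c}$. Then, with probability not less than $1-\sqrt{q_+/q_-}$, there will never be any particles to the left of $0$ (i.e. at a strictly negative position).
   Context: Branching particle system with parameters $(q_+,q_-,\beta)$. Each particle has a type in $\{+,-\}$ and a position in $\mathbb{R}$. A particle of type $+$ moves right at speed $1$; a particle of type $-$ moves left at speed $1$. A particle of type $+$ flips to type $-$ at rate $q_+$, and a particle of type $-$ flips to type $+$ at rate $q_-$. In addition each particle, whatever its type, dies at rate $\beta$ and at its death gives birth to two daughter particles, which start with the same type and position as their parent had at its death. The usual independence conditions hold: all the exponential clocks are independent, and, given the birth time, initial type and initial position of particles, the subsequent evolutions of distinct particles and of their progeny are independent. *)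

theory Defs
  imports "HOL-Probability.Probability"
begin

datatype ptype = Plus | Minus

primrec flip_type :: "ptype \<Rightarrow> ptype" where
  "flip_type Plus = Minus"
| "flip_type Minus = Plus"

primrec velocity :: "ptype \<Rightarrow> real" where
  "velocity Plus = 1"
| "velocity Minus = -1"

text \<open>Particles are the nodes of the infinite binary tree (every particle dies and has two
  daughters): \<open>[]\<close> is the initial particle, and \<open>True # u\<close>, \<open>False # u\<close> are the daughters of \<open>u\<close>.
  \<open>Death u\<close> is the clock measuring the lifetime of \<open>u\<close>; \<open>Flip u s n\<close> is the clock of type \<open>s\<close>
  that \<open>u\<close> uses after having flipped \<open>n\<close> times in its life, provided its type is then \<open>s\<close>
  (otherwise this clock is never read).\<close>

datatype clock = Death "bool list" | Flip "bool list" ptype nat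

fun clock_rate :: "real \<Rightarrow> real \<Rightarrow> real \<Rightarrow> clock \<Rightarrow> real" where
  "clock_rate qp qm \<beta> (Death u) = \<beta>"
| "clock_rate qp qm \<beta> (Flip u Plus n) = qp"
| "clock_rate qp qm \<beta> (Flip u Minus n) = qm"

definition branching_clocks ::
    "real \<Rightarrow> real \<Rightarrow> real \<Rightarrow> 'a measure \<Rightarrow> (clock \<Rightarrow> 'a \<Rightarrow> real) \<Rightarrow> bool" where
  "branching_clocks qp qm \<beta> M C \<longleftrightarrow>
     prob_space M \<and>
     prob_space.indep_vars M (\<lambda>_. borel) C UNIV \<and>
     (\<forall>c. distributed M lborel (C c) (exponential_density (clock_rate qp qm \<beta> c)))"

text \<open>The motion of one particle during its life, as a function of its initial type \<open>s\<close> and of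
  the durations \<open>h\<close>: the period between the \<open>n\<close>-th and the next flip lasts \<open>h r n\<close>, where \<open>r\<close>
  is the type during that period. The argument \<open>a\<close> is the age of the particle.\<close>

definition phase_type :: "ptype \<Rightarrow> nat \<Rightarrow> ptype" where
  "phase_type s n = (flip_type ^^ n) s"

definition flip_age :: "ptype \<Rightarrow> (ptype \<Rightarrow> nat \<Rightarrow> real) \<Rightarrow> nat \<Rightarrow> real" where
  "flip_age s h n = (\<Sum>k<n. h (phase_type s k) k)"

text \<open>The number of flips up to age \<open>a\<close>. The \<open>LEAST\<close> is unspecified only if infinitely many flips
  occur by age \<open>a\<close>, which has probability \<open>0\<close>.\<close>

definition flips_by :: "ptype \<Rightarrow> (ptype \<Rightarrow> nat \<Rightarrow> real) \<Rightarrow> real \<Rightarrow> nat" where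
  "flips_by s h a = (LEAST n. a < flip_age s h (Suc n))"

definition type_at_age :: "ptype \<Rightarrow> (ptype \<Rightarrow> nat \<Rightarrow> real) \<Rightarrow> real \<Rightarrow> ptype" where
  "type_at_age s h a = phase_type s (flips_by s h a)"

definition displacement :: "ptype \<Rightarrow> (ptype \<Rightarrow> nat \<Rightarrow> real) \<Rightarrow> real \<Rightarrow> real" where
  "displacement s h a =
     (let n = flips_by s h a in
        (\<Sum>k<n. velocity (phase_type s k) * h (phase_type s k) k)
        + velocity (phase_type s n) * (a - flip_age s h n))"

text \<open>The whole system, as a function of the values \<open>c\<close> of the clocks, started at time \<open>0\<close> with
  one particle of type \<open>s\<close> at position \<open>x\<close>.\<close>

abbreviation flip_durations :: "(clock \<Rightarrow> real) \<Rightarrow> bool list \<Rightarrow> ptype \<Rightarrow> nat \<Rightarrow> real" where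
  "flip_durations c u \<equiv> (\<lambda>r n. c (Flip u r n))"

primrec birth_time :: "(clock \<Rightarrow> real) \<Rightarrow> bool list \<Rightarrow> real" where
  "birth_time c [] = 0"
| "birth_time c (b # u) = birth_time c u + c (Death u)"

primrec birth_type :: "ptype \<Rightarrow> (clock \<Rightarrow> real) \<Rightarrow> bool list \<Rightarrow> ptype" where
  "birth_type s c [] = s"
| "birth_type s c (b # u) = type_at_age (birth_type s c u) (flip_durations c u) (c (Death u))"

primrec birth_position :: "ptype \<Rightarrow> real \<Rightarrow> (clock \<Rightarrow> real) \<Rightarrow> bool list \<Rightarrow> real" where
  "birth_position s x c [] = x"
| "birth_position s x c (b # u) =
     birth_position s x c u + displacement (birth_type s c u) (flip_durations c u) (c (Death u))"

definition alive_at :: "(clock \<Rightarrow> real) \<Rightarrow> bool list \<Rightarrow> real \<Rightarrow> bool" where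
  "alive_at c u t \<longleftrightarrow> birth_time c u \<le> t \<and> t < birth_time c u + c (Death u)"

text \<open>Meaningful only at times \<open>t\<close> when the particle \<open>u\<close> is alive.\<close>

definition position_at :: "ptype \<Rightarrow> real \<Rightarrow> (clock \<Rightarrow> real) \<Rightarrow> bool list \<Rightarrow> real \<Rightarrow> real" where
  "position_at s x c u t =
     birth_position s x c u
     + displacement (birth_type s c u) (flip_durations c u) (t - birth_time c u)"

end

theory Submission
  imports Defs
begin

text \<open>Let \<open>w s x\<close> be the probability that, started from one particle of type \<open>s\<close> at \<open>x\<close>, some particle ever
has a strictly negative position. Wait for the first event, a flip of the initial particle or its
death. The exponential clocks are memoryless and the two daughters evolve independently, so that for
\<open>x \<ge> 0\<close>
\[ w_s(x) = \int_0^\infty e^{-(q_s+\beta)t}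
     \bigl(q_s\, w_{s'}(x + v_s t) + \beta\,(2w_s - w_s^2)(x + v_s t)\bigr)\,dt , \]
where \<open>s'\<close> is the other type and \<open>v\<^sub>s = \<plusminus>1\<close> the velocity, and \<open>w = 1\<close> on the negative half-line
(\<open>reach_prob_eq\<close>). Moreover \<open>w\<close> is the limit of the iterates of the right-hand side that start from
the indicator of the negative half-line: the \<open>n\<close>-th iterate is the probability of success within
\<open>n\<close> events (\<open>hit_prob_Suc\<close>).

Part (b) is a first-moment bound. Dropping the square where the position is nonnegative makes the
equation linear. The function
\<open>exp (\<theta> x)\<close> for type \<open>-\<close>, and \<open>\<rho> exp (\<theta> x)\<close> with \<open>\<rho> = \<surd>(q\<^sub>+/q\<^sub>-)\<close> for type \<open>+\<close>, is a supersolution of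
the linear equation as soon as \<open>\<theta>\<close> satisfies
\<open>\<beta> + \<surd>(q\<^sub>+q\<^sub>-) - q\<^sub>- \<le> \<theta> \<le> q\<^sub>+ - \<beta> - \<surd>(q\<^sub>+q\<^sub>-)\<close>, and such a \<open>\<theta>\<close> exists exactly when \<open>\<beta> \<le> \<beta>\<^sub>c\<close>. By induction
all iterates, hence also \<open>w\<close>, lie below it (\<open>hit_prob_bound\<close>), and its value for type \<open>+\<close> at \<open>0\<close> is \<open>\<rho>\<close>.

For part (a), the integral equation makes \<open>w\<close> continuously differentiable on \<open>x > 0\<close>, with
\<open>w\<^sub>+' = q\<^sub>+(w\<^sub>+ - w\<^sub>-) - \<beta> w\<^sub>+(1 - w\<^sub>+)\<close> and \<open>w\<^sub>-' = q\<^sub>-(w\<^sub>+ - w\<^sub>-) + \<beta> w\<^sub>-(1 - w\<^sub>-)\<close>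
(\<open>reach_prob_deriv\<close>). Both functions decrease, and their limits at infinity form a stationary point,
so they are both \<open>0\<close> or both \<open>1\<close>. If they were \<open>0\<close>, then far out the ratio \<open>r = w\<^sub>-/w\<^sub>+\<close> would obey the
Riccati equation \<open>r' = q\<^sub>+ r\<^sup>2 - (q\<^sub>+ + q\<^sub>- - 2\<beta>) r + q\<^sub>-\<close> up to a small multiple of \<open>r\<close>. For \<open>\<beta> > \<beta>\<^sub>c\<close> its
right-hand side is at least a positive multiple of \<open>1 + r\<^sup>2\<close> for \<open>r \<ge> 0\<close> (\<open>discriminant_bound\<close>), so \<open>r\<close>
would explode at a finite \<open>x\<close>, which is absurd (\<open>not_small\<close>). Hence \<open>w\<^sub>+ = 1\<close> at every height: by
translation, almost surely there are particles below every level. A single life covers only a bounded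
distance, so infinitely many particles visit the negative half-line (\<open>infinitely_many_negative\<close>).\<close>

section \<open>One event at a time\<close>

text \<open>A node of the tree lists the choices of daughters with the most recent one first. The progeny of the
daughter \<open>b\<close> of the initial particle therefore consists of the nodes \<open>u @ [b]\<close>.\<close>

fun daughter_clock :: "bool \<Rightarrow> clock \<Rightarrow> clock" where
  "daughter_clock b (Death u) = Death (u @ [b])"
| "daughter_clock b (Flip u s n) = Flip (u @ [b]) s n"

text \<open>The clocks of the initial particle that are read after its first flip. The flip counter is shifted for
both types, which keeps the map injective and independent of the initial type.\<close>

fun later_clock :: "clock \<Rightarrow> clock" where
  "later_clock (Flip [] s n) = Flip [] s (Suc n)"
| "later_clock (Flip (b # u) s n) = Flip (b # u) s n"
| "later_clock (Death u) = Death u"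

definition daughter :: "bool \<Rightarrow> (clock \<Rightarrow> real) \<Rightarrow> clock \<Rightarrow> real" where
  "daughter b c = (\<lambda>i. c (daughter_clock b i))"

text \<open>The system watched from the first flip of the initial particle on: a system started by a particle of
the other type, whose lifetime is what remains of the old one.\<close>

definition after_flip :: "ptype \<Rightarrow> (clock \<Rightarrow> real) \<Rightarrow> clock \<Rightarrow> real" where
  "after_flip s c = (\<lambda>i. c (later_clock i))(Death [] := c (Death []) - c (Flip [] s 0))"

text \<open>Some line of descent reaches the negative half-line within \<open>n\<close> events, an event being a flip or a death of
the particle that is currently followed. It suffices to test the position at the events: between two of
them the motion is straight, so a run from a nonnegative position visits the negative half-line if and
only if it ends there. If a flip and a death coincide then the flip comes first, because at the flip time
the new type is already in force.\<close>

primrec hits :: "nat \<Rightarrow> ptype \<Rightarrow> real \<Rightarrow> (clock \<Rightarrow> real) \<Rightarrow> bool" where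
  "hits 0 s x c \<longleftrightarrow> x < 0"
| "hits (Suc n) s x c \<longleftrightarrow> x < 0 \<or>
     (if c (Death []) < c (Flip [] s 0)
      then \<exists>b. hits n s (x + velocity s * c (Death [])) (daughter b c)
      else hits n (flip_type s) (x + velocity s * c (Flip [] s 0)) (after_flip s c))"

text \<open>Almost all clock values are regular. Lifetimes are allowed to vanish so that regularity survives
\<open>after_flip\<close>: a flip at the very moment of death leaves the residual lifetime \<open>0\<close>.\<close>

definition regular :: "(clock \<Rightarrow> real) \<Rightarrow> bool" where
  "regular c \<longleftrightarrow> (\<forall>u. 0 \<le> c (Death u)) \<and> (\<forall>u s n. 0 < c (Flip u s n)) \<and>
     (\<forall>u s a. \<exists>n. a < flip_age s (flip_durations c u) n)"

definition reaches_negative :: "ptype \<Rightarrow> real \<Rightarrow> (clock \<Rightarrow> real) \<Rightarrow> bool list \<Rightarrow> bool" where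
  "reaches_negative s x c u \<longleftrightarrow> (\<exists>t\<ge>0. alive_at c u t \<and> position_at s x c u t < 0)"

lemma phase_type_Suc: "phase_type s (Suc n) = phase_type (flip_type s) n"
  by (simp add: phase_type_def funpow_swap1)

lemma phase_type_0 [simp]: "phase_type s 0 = s"
  by (simp add: phase_type_def)

lemma flip_age_0 [simp]: "flip_age s h 0 = 0"
  by (simp add: flip_age_def)

lemma flip_age_Suc:
  "flip_age s h (Suc n) = h s 0 + flip_age (flip_type s) (\<lambda>r k. h r (Suc k)) n"
  unfolding flip_age_def sum.lessThan_Suc_shift by (simp add: phase_type_Suc)

lemma flips_by_before_flip: "a < h s 0 \<Longrightarrow> flips_by s h a = 0"
  unfolding flips_by_def by (rule Least_equality) (auto simp: flip_age_Suc)

lemma flips_by_after_flip: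
  assumes "h s 0 \<le> a" and "0 \<le> h s 0" and "\<exists>n. a < flip_age s h n"
  shows "flips_by s h a = Suc (flips_by (flip_type s) (\<lambda>r k. h r (Suc k)) (a - h s 0))"
proof -
  let ?P = "\<lambda>n. a < flip_age s h (Suc n)"
  have n0: "\<not> ?P 0" using assms(1) by (simp add: flip_age_Suc)
  obtain n where n: "a < flip_age s h n" using assms(3) by blast
  then have "n \<noteq> 0" using assms(1,2) by (intro notI) simp
  then have "?P (n - 1)" using n by simp
  then have "(LEAST n. ?P n) = Suc (LEAST m. ?P (Suc m))"
    using n0 by (intro Least_Suc)
  moreover have "?P (Suc m) \<longleftrightarrow> a - h s 0 < flip_age (flip_type s) (\<lambda>r k. h r (Suc k)) (Suc m)" for m
    by (subst flip_age_Suc) auto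
  ultimately show ?thesis
    unfolding flips_by_def by simp
qed

lemma type_at_age_before_flip: "a < h s 0 \<Longrightarrow> type_at_age s h a = s"
  by (simp add: type_at_age_def flips_by_before_flip)

lemma displacement_before_flip: "a < h s 0 \<Longrightarrow> displacement s h a = velocity s * a"
  by (simp add: displacement_def flips_by_before_flip)

lemma type_at_age_after_flip:
  assumes "h s 0 \<le> a" and "0 \<le> h s 0" and "\<exists>n. a < flip_age s h n"
  shows "type_at_age s h a = type_at_age (flip_type s) (\<lambda>r k. h r (Suc k)) (a - h s 0)"
  using flips_by_after_flip[of h s, OF assms] by (simp add: type_at_age_def phase_type_Suc)

lemma displacement_after_flip:
  assumes "h s 0 \<le> a" and "0 \<le> h s 0" and "\<exists>n. a < flip_age s h n"
  shows "displacement s h a =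
    velocity s * h s 0 + displacement (flip_type s) (\<lambda>r k. h r (Suc k)) (a - h s 0)"
  using flips_by_after_flip[of h s, OF assms]
  by (simp add: displacement_def Let_def phase_type_Suc flip_age_Suc sum.lessThan_Suc_shift
      algebra_simps del: sum.lessThan_Suc)

lemma birth_type_daughter:
  "birth_type s c (u @ [b]) =
    birth_type (type_at_age s (flip_durations c []) (c (Death []))) (daughter b c) u"
  by (induction u) (auto simp: daughter_def)

lemma birth_position_daughter:
  "birth_position s x c (u @ [b]) =
    birth_position (type_at_age s (flip_durations c []) (c (Death [])))
      (x + displacement s (flip_durations c []) (c (Death []))) (daughter b c) u"
  by (induction u) (auto simp: daughter_def birth_type_daughter[unfolded daughter_def])

lemma after_flip_simps [simp]:
  "after_flip s c (Death []) = c (Death []) - c (Flip [] s 0)"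
  "after_flip s c (Death (b # u)) = c (Death (b # u))"
  "after_flip s c (Flip [] r k) = c (Flip [] r (Suc k))"
  "after_flip s c (Flip (b # u) r k) = c (Flip (b # u) r k)"
  by (auto simp: after_flip_def)

lemma regular_daughter: "regular c \<Longrightarrow> regular (daughter b c)"
  by (auto simp: regular_def daughter_def)

lemma regularD:
  assumes "regular c"
  shows "0 \<le> c (Death u)" "0 < c (Flip u s n)" "\<exists>n. a < flip_age s (flip_durations c u) n"
  using assms by (auto simp: regular_def)

lemma regular_after_flip:
  assumes "regular c" and "c (Flip [] s 0) \<le> c (Death [])"
  shows "regular (after_flip s c)"
proof -
  have "0 \<le> after_flip s c (Death u)" for u
    using assms by (cases u) (auto simp: regular_def)
  moreover have "0 < after_flip s c (Flip u r n)" for u r n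
    using assms by (cases u) (auto simp: regular_def)
  moreover have "\<exists>n. a < flip_age r (flip_durations (after_flip s c) u) n" for u r a
  proof (cases u)
    case Nil
    obtain n where n: "max 0 (a + c (Flip [] (flip_type r) 0))
        < flip_age (flip_type r) (flip_durations c []) n"
      using regularD(3)[OF assms(1)] by blast
    then obtain m where "n = Suc m" by (cases n) auto
    then show ?thesis using n Nil by (intro exI[of _ m]) (cases r; simp add: flip_age_Suc)
  next
    case (Cons b v)
    then show ?thesis using regularD(3)[OF assms(1)] by simp
  qed
  ultimately show ?thesis by (simp add: regular_def)
qed

lemma birth_type_after_flip:
  assumes "regular c" and "c (Flip [] s 0) \<le> c (Death [])"
  shows "u \<noteq> [] \<Longrightarrow> birth_type s c u = birth_type (flip_type s) (after_flip s c) u"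
proof (induction u)
  case (Cons b u)
  show ?case
  proof (cases u)
    case Nil
    then show ?thesis
      using type_at_age_after_flip[of "flip_durations c []" s "c (Death [])"] assms
        regularD(2,3)[OF assms(1)] by (simp add: less_imp_le)
  qed (use Cons in auto)
qed simp

lemma birth_position_after_flip:
  assumes "regular c" and "c (Flip [] s 0) \<le> c (Death [])"
  shows "u \<noteq> [] \<Longrightarrow> birth_position s x c u =
    birth_position (flip_type s) (x + velocity s * c (Flip [] s 0)) (after_flip s c) u"
proof (induction u)
  case (Cons b u)
  show ?case
  proof (cases "u = []")
    case True
    then show ?thesis
      using displacement_after_flip[of "flip_durations c []" s "c (Death [])"] assms
        regularD(2,3)[OF assms(1)] by (simp add: less_imp_le)
  next
    case False
    then obtain b' v where "u = b' # v" by (cases u) auto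
    then have "after_flip s c (Death u) = c (Death u)"
        "flip_durations (after_flip s c) u = flip_durations c u" by auto
    then show ?thesis using Cons.IH[OF False] birth_type_after_flip[OF assms False] by simp
  qed
qed simp

lemma birth_time_nonneg: "regular c \<Longrightarrow> 0 \<le> birth_time c u"
  by (induction u) (auto simp: regular_def)

text \<open>In terms of the age of the particle its birth time disappears, and only types and positions have to be
followed through the first event.\<close>

lemma reaches_negative_iff_age:
  assumes "regular c"
  shows "reaches_negative s x c u \<longleftrightarrow> (\<exists>a\<ge>0. a < c (Death u) \<and>
    birth_position s x c u + displacement (birth_type s c u) (flip_durations c u) a < 0)"
    (is "_ \<longleftrightarrow> ?R")
proof
  assume "reaches_negative s x c u"
  then obtain t where "t \<ge> 0" "alive_at c u t" "position_at s x c u t < 0"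
    by (auto simp: reaches_negative_def)
  then show ?R
    by (intro exI[of _ "t - birth_time c u"]) (auto simp: alive_at_def position_at_def)
next
  assume ?R
  then obtain a where "0 \<le> a" "a < c (Death u)"
    "birth_position s x c u + displacement (birth_type s c u) (flip_durations c u) a < 0" by blast
  then show "reaches_negative s x c u"
    using birth_time_nonneg[OF assms, of u] unfolding reaches_negative_def
    by (intro exI[of _ "a + birth_time c u"]) (auto simp: alive_at_def position_at_def)
qed

lemma reaches_negative_daughter:
  assumes "regular c" and "c (Death []) < c (Flip [] s 0)"
  shows "reaches_negative s x c (u @ [b]) \<longleftrightarrow>
    reaches_negative s (x + velocity s * c (Death [])) (daughter b c) u"
  unfolding reaches_negative_iff_age[OF assms(1)]
    reaches_negative_iff_age[OF regular_daughter[OF assms(1)]]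
    birth_type_daughter birth_position_daughter
  using assms(2) by (simp add: daughter_def type_at_age_before_flip displacement_before_flip)

text \<open>Up to its first flip the initial particle runs straight. From then on it, and its progeny, are those of
the shifted system.\<close>

lemma reaches_negative_after_flip:
  assumes "regular c" and "c (Flip [] s 0) \<le> c (Death [])"
  shows "reaches_negative s x c u \<longleftrightarrow>
    u = [] \<and> (\<exists>a\<ge>0. a < c (Flip [] s 0) \<and> x + velocity s * a < 0) \<or>
    reaches_negative (flip_type s) (x + velocity s * c (Flip [] s 0)) (after_flip s c) u"
proof (cases u)
  case Nil
  let ?T = "c (Flip [] s 0)"
  have T: "0 < ?T" using assms(1) by (rule regularD)
  have after: "displacement s (flip_durations c []) a = velocity s * ?T +
      displacement (flip_type s) (flip_durations (after_flip s c) []) (a - ?T)" if "?T \<le> a" for a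
    using displacement_after_flip[of "flip_durations c []" s a] that T regularD(3)[OF assms(1)] by simp
  have "reaches_negative s x c [] \<longleftrightarrow> (\<exists>a\<ge>0. a < c (Death []) \<and>
      x + displacement s (flip_durations c []) a < 0)"
    by (simp add: reaches_negative_iff_age[OF assms(1)])
  also have "\<dots> \<longleftrightarrow> (\<exists>a\<ge>0. a < ?T \<and> x + velocity s * a < 0) \<or>
     (\<exists>a\<ge>?T. a < c (Death []) \<and> x + displacement s (flip_durations c []) a < 0)"
    using assms(2) T displacement_before_flip[of _ "flip_durations c []" s]
    by (smt (verit, best))
  also have "(\<exists>a\<ge>?T. a < c (Death []) \<and> x + displacement s (flip_durations c []) a < 0) \<longleftrightarrow>
     (\<exists>a\<ge>0. a < c (Death []) - ?T \<and> x + velocity s * ?T +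
        displacement (flip_type s) (flip_durations (after_flip s c) []) a < 0)" (is "?A \<longleftrightarrow> ?B")
  proof
    assume ?A
    then obtain a where "a \<ge> ?T" "a < c (Death [])" "x + displacement s (flip_durations c []) a < 0"
      by blast
    then show ?B using after[of a] by (intro exI[of _ "a - ?T"]) (auto simp: algebra_simps)
  next
    assume ?B
    then obtain a where "a \<ge> 0" "a < c (Death []) - ?T" "x + velocity s * ?T +
        displacement (flip_type s) (flip_durations (after_flip s c) []) a < 0"
      by blast
    then show ?A using after[of "a + ?T"] by (intro exI[of _ "a + ?T"]) (auto simp: algebra_simps)
  qed
  finally show ?thesis
    using Nil by (simp add: reaches_negative_iff_age[OF regular_after_flip[OF assms]])
next
  case (Cons b v)
  then show ?thesis
    unfolding reaches_negative_iff_age[OF assms(1)]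
      reaches_negative_iff_age[OF regular_after_flip[OF assms]]
    using birth_type_after_flip[OF assms, of u] birth_position_after_flip[OF assms, of u x]
    by simp
qed

text \<open>A strictly negative end point is approached through strictly negative points, so the half-open duration
of a run loses nothing.\<close>

lemma straight_run_hits:
  assumes "0 \<le> x" and "0 \<le> l"
  shows "(\<exists>a\<ge>0. a < l \<and> x + velocity s * a < 0) \<longleftrightarrow> x + velocity s * l < 0"
proof (cases s)
  case Plus
  then show ?thesis using assms by auto
next
  case Minus
  show ?thesis
  proof
    assume "x + velocity s * l < 0"
    then show "\<exists>a\<ge>0. a < l \<and> x + velocity s * a < 0"
      using Minus assms by (intro exI[of _ "(x + l) / 2"]) (auto simp: field_simps)
  qed (use Minus in auto)
qed

lemma hits_neg: "x < 0 \<Longrightarrow> hits n s x c"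
  by (cases n) auto

lemma hits_imp_reaches_negative:
  "hits n s x c \<Longrightarrow> regular c \<Longrightarrow> x < 0 \<or> (\<exists>u. reaches_negative s x c u)"
proof (induction n arbitrary: s x c)
  case (Suc n)
  note c = \<open>regular c\<close>
  show ?case
  proof (cases "x < 0")
    case False
    then have x: "0 \<le> x" by simp
    show ?thesis
    proof (cases "c (Death []) < c (Flip [] s 0)")
      case True
      let ?y = "x + velocity s * c (Death [])"
      obtain b where "hits n s ?y (daughter b c)" using Suc.prems True x by auto
      then consider "?y < 0" | u where "reaches_negative s ?y (daughter b c) u"
        using Suc.IH regular_daughter[OF c] by blast
      then show ?thesis
      proof cases
        case 1
        then obtain a where "0 \<le> a" "a < c (Death [])" "x + velocity s * a < 0"
          using straight_run_hits[OF x, of "c (Death [])" s] regularD(1)[OF c] by auto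
        then have "reaches_negative s x c []"
          using True displacement_before_flip[of a "flip_durations c []" s]
          by (auto simp: reaches_negative_iff_age[OF c])
        then show ?thesis by blast
      qed (use reaches_negative_daughter[OF c True] in blast)
    next
      case False
      then have TD: "c (Flip [] s 0) \<le> c (Death [])" by simp
      let ?y = "x + velocity s * c (Flip [] s 0)"
      have "hits n (flip_type s) ?y (after_flip s c)" using Suc.prems False x by auto
      then have "?y < 0 \<or> (\<exists>u. reaches_negative (flip_type s) ?y (after_flip s c) u)"
        using Suc.IH regular_after_flip[OF c TD] by blast
      then show ?thesis
        using reaches_negative_after_flip[OF c TD, of x] straight_run_hits[OF x, of "c (Flip [] s 0)" s]
          regularD(2)[OF c, of "[]" s 0] by fastforce
    qed
  qed simp
qed simp

text \<open>The witness descends along the first events. Passing to a daughter shortens the path from the initial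
particle to \<open>u\<close>; passing a flip keeps that path and lowers the number of flips during the life of the
initial particle. Regularity makes this number the true, finite one.\<close>

lemma reaches_negative_imp_hits:
  "regular c \<Longrightarrow> reaches_negative s x c u \<Longrightarrow> \<exists>n. hits n s x c"
proof (induction "(length u, flips_by s (flip_durations c []) (c (Death [])))"
    arbitrary: s x c u rule: wf_induct[OF wf_lex_prod[OF wf_less_than wf_less_than]])
  case 1
  note c = \<open>regular c\<close>
  have IH: "\<exists>n. hits n s' x' c'"
    if "regular c'" "reaches_negative s' x' c' u'" "length u' < length u \<or> length u' = length u \<and>
     flips_by s' (flip_durations c' []) (c' (Death [])) < flips_by s (flip_durations c []) (c (Death []))"
    for s' x' c' u'
    using 1(1)[rule_format, of "(length u', flips_by s' (flip_durations c' []) (c' (Death [])))"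
        u' s' c' x'] that by auto
  show ?case
  proof (cases "x < 0")
    case True
    then show ?thesis by (intro exI[of _ 0]) simp
  next
    case False
    then have x: "0 \<le> x" by simp
    show ?thesis
    proof (cases "c (Death []) < c (Flip [] s 0)")
      case True
      let ?y = "x + velocity s * c (Death [])"
      have "\<exists>n b. hits n s ?y (daughter b c)"
      proof (cases u rule: rev_cases)
        case Nil
        then obtain a where "0 \<le> a" "a < c (Death [])" "x + velocity s * a < 0"
          using 1(3) True displacement_before_flip[of _ "flip_durations c []" s]
          by (fastforce simp: reaches_negative_iff_age[OF c])
        then have "?y < 0" using straight_run_hits[OF x, of "c (Death [])" s] by auto
        then show ?thesis by (intro exI[of _ 0]) simp
      next
        case (snoc v b)
        then show ?thesis
          using IH[OF regular_daughter[OF c]] reaches_negative_daughter[OF c True] 1(3) by fastforce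
      qed
      then obtain n where "\<exists>b. hits n s ?y (daughter b c)" by blast
      then show ?thesis using True by (intro exI[of _ "Suc n"]) simp
    next
      case False
      then have TD: "c (Flip [] s 0) \<le> c (Death [])" by simp
      let ?y = "x + velocity s * c (Flip [] s 0)"
      have T: "0 < c (Flip [] s 0)" using c by (rule regularD)
      have "\<exists>n. hits n (flip_type s) ?y (after_flip s c)"
      proof (cases "reaches_negative (flip_type s) ?y (after_flip s c) u")
        case True
        have "flips_by s (flip_durations c []) (c (Death [])) =
          Suc (flips_by (flip_type s) (flip_durations (after_flip s c) []) (after_flip s c (Death [])))"
          using flips_by_after_flip[of "flip_durations c []" s "c (Death [])"] TD T
            regularD(3)[OF c] by simp
        then show ?thesis using IH[OF regular_after_flip[OF c TD] True] by simp
      next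
        case False
        then obtain a where "0 \<le> a" "a < c (Flip [] s 0)" "x + velocity s * a < 0"
          using 1(3) reaches_negative_after_flip[OF c TD] by blast
        then have "?y < 0" using straight_run_hits[OF x, of "c (Flip [] s 0)" s] by auto
        then show ?thesis by (intro exI[of _ 0]) simp
      qed
      then obtain n where "hits n (flip_type s) ?y (after_flip s c)" by blast
      then show ?thesis using False by (intro exI[of _ "Suc n"]) simp
    qed
  qed
qed

theorem ex_hits_iff_reaches_negative:
  assumes "regular c" and "0 \<le> x"
  shows "(\<exists>n. hits n s x c) \<longleftrightarrow> (\<exists>u. reaches_negative s x c u)"
  using assms hits_imp_reaches_negative reaches_negative_imp_hits by fastforce

section \<open>Displacement during one life\<close>

lemma velocity_abs [simp]: "\<bar>velocity s\<bar> = 1"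
  by (cases s) auto

text \<open>The speed is \<open>1\<close>. This is what bounds the contribution of each single particle in the final argument.\<close>

lemma displacement_ge_neg_age:
  assumes "\<And>r n. 0 < h r n" and "0 \<le> a" and "\<exists>n. a < flip_age s h n"
  shows "- a \<le> displacement s h a"
proof -
  define n where "n = flips_by s h a"
  have age: "flip_age s h n \<le> a"
  proof (cases n)
    case (Suc m)
    then show ?thesis
      using not_less_Least[of m "\<lambda>n. a < flip_age s h (Suc n)"] by (auto simp: n_def flips_by_def)
  qed (use assms(2) in simp)
  have vel: "- 1 \<le> velocity r" for r by (cases r) auto
  have "- flip_age s h n \<le> (\<Sum>k<n. velocity (phase_type s k) * h (phase_type s k) k)"
    unfolding flip_age_def sum_negf[symmetric]
  proof (rule sum_mono)
    fix k
    show "- h (phase_type s k) k \<le> velocity (phase_type s k) * h (phase_type s k) k"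
      using mult_right_mono[OF vel, of "h (phase_type s k) k" "phase_type s k"] assms(1)
      by (simp add: less_imp_le)
  qed
  moreover have "- (a - flip_age s h n) \<le> velocity (phase_type s n) * (a - flip_age s h n)"
    using mult_right_mono[OF vel, of "a - flip_age s h n" "phase_type s n"] age by simp
  ultimately show ?thesis
    by (simp add: displacement_def Let_def n_def[symmetric])
qed

text \<open>This also covers the case of infinitely many flips by age \<open>a\<close>: then no index qualifies at any later age
either, and \<open>LEAST\<close> returns the same unspecified number throughout.\<close>

lemma flips_by_right_constant:
  "\<exists>e>0. \<forall>a'. a \<le> a' \<and> a' < a + e \<longrightarrow> flips_by s h a' = flips_by s h a"
proof (cases "\<exists>n. a < flip_age s h (Suc n)")
  case True
  define N where "N = flips_by s h a"
  have N: "a < flip_age s h (Suc N)"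
    using LeastI_ex[of "\<lambda>n. a < flip_age s h (Suc n)", OF True] by (simp only: N_def flips_by_def)
  have min: "flip_age s h (Suc k) \<le> a" if "k < N" for k
  proof -
    have "k < (LEAST n. a < flip_age s h (Suc n))" using that by (simp only: N_def flips_by_def)
    from not_less_Least[OF this] show ?thesis by (simp only: not_less)
  qed
  have same: "flips_by s h a' = N" if "a \<le> a'" "a' < flip_age s h (Suc N)" for a'
    unfolding flips_by_def
  proof (rule Least_equality)
    show "a' < flip_age s h (Suc N)" by (rule that(2))
    show "N \<le> k" if "a' < flip_age s h (Suc k)" for k
    proof (rule ccontr)
      assume "\<not> N \<le> k"
      then have "flip_age s h (Suc k) \<le> a" by (intro min) simp
      then show False using that \<open>a \<le> a'\<close> by linarith
    qed
  qed
  show ?thesis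
  proof (intro exI[of _ "flip_age s h (Suc N) - a"] conjI allI impI)
    show "flips_by s h a' = flips_by s h a" if "a \<le> a' \<and> a' < a + (flip_age s h (Suc N) - a)" for a'
      unfolding N_def[symmetric] by (rule same) (use that in linarith)+
  qed (use N in linarith)
next
  case False
  have "flips_by s h a' = flips_by s h a" if "a \<le> a'" for a'
  proof -
    have 1: "a < flip_age s h (Suc n) \<longleftrightarrow> False" for n using False by blast
    have 2: "a' < flip_age s h (Suc n) \<longleftrightarrow> False" for n
      using 1[of n] that by (simp add: not_less)
    show ?thesis unfolding flips_by_def 1 2 ..
  qed
  then show ?thesis by (meson zero_less_one)
qed

text \<open>Positions are right-continuous in time, for all clock values. The event that a particle visits the
negative half-line is thus measurable exactly and not only up to a null set, as it has to be in a
probability space that may be incomplete.\<close>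

lemma rational_time_suffices:
  assumes "alive_at c u t" and "0 \<le> t" and "position_at s x c u t < 0"
  shows "\<exists>q::rat. 0 \<le> q \<and> alive_at c u (of_rat q) \<and> position_at s x c u (of_rat q) < 0"
proof -
  define S h b p where "S = birth_type s c u" and "h = flip_durations c u"
    and "b = birth_time c u" and "p = position_at s x c u t"
  obtain e where e: "e > 0" "\<And>a'. t - b \<le> a' \<Longrightarrow> a' < t - b + e \<Longrightarrow> flips_by S h a' = flips_by S h (t - b)"
    using flips_by_right_constant[of "t - b" S h] by blast
  let ?v = "velocity (phase_type S (flips_by S h (t - b)))"
  have disp: "position_at s x c u t' = p + ?v * (t' - t)" if "t \<le> t'" "t' < t + e" for t'
    using e(2)[of "t' - b"] that
    unfolding p_def position_at_def displacement_def Let_def S_def[symmetric] h_def[symmetric]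
      b_def[symmetric] by (simp add: algebra_simps)
  have "t < min (t + e) (min (b + c (Death u)) (t - p))"
    using e(1) assms by (auto simp: alive_at_def b_def p_def)
  then obtain q where q: "t < of_rat q" "of_rat q < min (t + e) (min (b + c (Death u)) (t - p))"
    using of_rat_dense by blast
  have "?v * (of_rat q - t) \<le> of_rat q - t"
    using q(1) by (cases "phase_type S (flips_by S h (t - b))") auto
  moreover have "position_at s x c u (of_rat q) = p + ?v * (of_rat q - t)"
    using disp[of "of_rat q"] q by simp
  ultimately have "position_at s x c u (of_rat q) < 0"
    using q(2) by linarith
  moreover have "alive_at c u (of_rat q)"
    using q assms(1) unfolding alive_at_def b_def by simp
  moreover have "0 \<le> q"
    using q(1) assms(2) zero_le_of_rat_iff[of q, where 'a = real] by linarith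
  ultimately show ?thesis by (intro exI[of _ q] conjI)
qed

section \<open>Measurability\<close>

instance ptype :: countable by countable_datatype
instance clock :: countable by countable_datatype

abbreviation clock_space :: "(clock \<Rightarrow> real) measure" where
  "clock_space \<equiv> PiM UNIV (\<lambda>_. borel)"

lemma measurable_into_clock_space:
  assumes "\<And>i. (\<lambda>w. f w i) \<in> borel_measurable N"
  shows "f \<in> N \<rightarrow>\<^sub>M clock_space"
  by (rule measurable_PiM_single'[of UNIV "\<lambda>i w. f w i" N "\<lambda>_. borel"]) (use assms in auto)

lemma measurable_daughter [measurable]: "daughter b \<in> clock_space \<rightarrow>\<^sub>M clock_space"
  by (rule measurable_into_clock_space) (simp add: daughter_def)

lemma measurable_after_flip [measurable]: "after_flip s \<in> clock_space \<rightarrow>\<^sub>M clock_space"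
proof (rule measurable_into_clock_space)
  fix i
  show "(\<lambda>c. after_flip s c i) \<in> borel_measurable clock_space"
    by (cases "i = Death []") (simp_all add: after_flip_def)
qed

lemma measurable_hits [measurable]:
  "Measurable.pred (borel \<Otimes>\<^sub>M clock_space) (\<lambda>p. hits n s (fst p) (snd p))"
proof (induction n arbitrary: s)
  case 0
  then show ?case by simp
next
  case (Suc n)
  have [measurable]: "Measurable.pred N (\<lambda>w. hits n r (f w) (g w))"
    if "f \<in> borel_measurable N" "g \<in> N \<rightarrow>\<^sub>M clock_space" for f g r and N :: "(real \<times> (clock \<Rightarrow> real)) measure"
    using measurable_compose[OF measurable_Pair[OF that] Suc.IH[of r]] by simp
  show ?case by simp
qed

lemma measurable_hits' [measurable (raw)]:
  assumes "f \<in> borel_measurable N" "g \<in> N \<rightarrow>\<^sub>M clock_space"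
  shows "Measurable.pred N (\<lambda>w. hits n s (f w) (g w))"
  using measurable_compose[OF measurable_Pair[OF assms] measurable_hits] by simp

lemma measurable_flip_age [measurable]:
  "(\<lambda>c. flip_age s (flip_durations c u) n) \<in> borel_measurable clock_space"
  unfolding flip_age_def by simp

lemma measurable_flips_by:
  assumes [measurable]: "f \<in> borel_measurable clock_space"
  shows "(\<lambda>c. flips_by s (flip_durations c u) (f c)) \<in> clock_space \<rightarrow>\<^sub>M count_space UNIV"
  unfolding flips_by_def by measurable

lemma measurable_displacement:
  assumes [measurable]: "f \<in> borel_measurable clock_space"
  shows "(\<lambda>c. displacement s (flip_durations c u) (f c)) \<in> borel_measurable clock_space"
  unfolding displacement_def Let_def
proof (rule measurable_compose_countable[OF _ measurable_flips_by[OF assms]])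
qed (unfold flip_age_def, measurable)

lemma measurable_birth_time [measurable]: "(\<lambda>c. birth_time c u) \<in> borel_measurable clock_space"
  by (induction u) simp_all

lemma measurable_birth_type [measurable]:
  "(\<lambda>c. birth_type s c u) \<in> clock_space \<rightarrow>\<^sub>M count_space UNIV"
proof (induction u)
  case (Cons b u)
  have "(\<lambda>c. type_at_age r (flip_durations c u) (c (Death u))) \<in> clock_space \<rightarrow>\<^sub>M count_space UNIV" for r
    unfolding type_at_age_def
    by (rule measurable_compose[OF measurable_flips_by]) simp_all
  from measurable_compose_countable[OF this Cons] show ?case by simp
qed simp

lemma measurable_birth_position [measurable]:
  "(\<lambda>c. birth_position s x c u) \<in> borel_measurable clock_space"
proof (induction u)
  case (Cons b u)
  have "(\<lambda>c. displacement r (flip_durations c u) (c (Death u))) \<in> borel_measurable clock_space" for r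
    by (rule measurable_displacement) simp
  from measurable_compose_countable[OF this measurable_birth_type] 
  have [measurable]: "(\<lambda>c. displacement (birth_type s c u) (flip_durations c u) (c (Death u))) \<in> borel_measurable clock_space" .
  note [measurable] = Cons
  show ?case by simp
qed simp

lemma measurable_position_at [measurable]:
  "(\<lambda>c. position_at s x c u t) \<in> borel_measurable clock_space"
proof -
  have "(\<lambda>c. displacement r (flip_durations c u) (t - birth_time c u)) \<in> borel_measurable clock_space" for r
    by (rule measurable_displacement) simp
  from measurable_compose_countable[OF this measurable_birth_type] 
  have [measurable]: "(\<lambda>c. displacement (birth_type s c u) (flip_durations c u) (t - birth_time c u)) \<in> borel_measurable clock_space" .
  show ?thesis unfolding position_at_def by simp
qed

lemma measurable_reaches_negative [measurable]:
  "Measurable.pred clock_space (\<lambda>c. reaches_negative s x c u)"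
proof -
  have "reaches_negative s x c u \<longleftrightarrow>
    (\<exists>q::rat. 0 \<le> q \<and> alive_at c u (of_rat q) \<and> position_at s x c u (of_rat q) < 0)" for c
  proof
    assume "\<exists>q::rat. 0 \<le> q \<and> alive_at c u (of_rat q) \<and> position_at s x c u (of_rat q) < 0"
    then obtain q :: rat where "0 \<le> q" "alive_at c u (of_rat q)" "position_at s x c u (of_rat q) < 0"
      by (elim exE conjE)
    then show "reaches_negative s x c u"
      unfolding reaches_negative_def by (intro exI[of _ "of_rat q"]) simp
  qed (unfold reaches_negative_def, elim exE conjE, rule rational_time_suffices)
  then have *: "(\<lambda>c. reaches_negative s x c u) = (\<lambda>c. \<exists>q::rat. 0 \<le> q \<and>
      (birth_time c u \<le> of_rat q \<and> of_rat q < birth_time c u + c (Death u)) \<and>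
      position_at s x c u (of_rat q) < 0)"
    by (simp add: alive_at_def fun_eq_iff)
  show ?thesis unfolding * by measurable
qed

section \<open>The law of the clocks\<close>

locale branching_rates =
  fixes qp qm \<beta> :: real
  assumes qp_pos: "0 < qp" and qm_pos: "0 < qm" and beta_pos: "0 < \<beta>"
begin

definition clock_law :: "clock \<Rightarrow> real measure" where
  "clock_law i = density lborel (exponential_density (clock_rate qp qm \<beta> i))"

definition system_law :: "(clock \<Rightarrow> real) measure" where
  "system_law = PiM UNIV clock_law"

definition flip_rate :: "ptype \<Rightarrow> real" where
  "flip_rate s = (case s of Plus \<Rightarrow> qp | Minus \<Rightarrow> qm)"

lemma clock_rate_Flip [simp]: "clock_rate qp qm \<beta> (Flip u s n) = flip_rate s"
  by (cases s) (auto simp: flip_rate_def)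

lemma flip_rate_pos: "0 < flip_rate s"
  using qp_pos qm_pos by (cases s) (auto simp: flip_rate_def)

lemma clock_rate_pos: "0 < clock_rate qp qm \<beta> i"
  using flip_rate_pos beta_pos by (cases i) auto

lemma prob_space_clock_law: "prob_space (clock_law i)"
  unfolding clock_law_def by (rule prob_space_exponential_density) (rule clock_rate_pos)

lemma sets_clock_law [measurable_cong, simp]: "sets (clock_law i) = sets borel"
  by (simp add: clock_law_def)

lemma space_clock_law [simp]: "space (clock_law i) = UNIV"
  by (simp add: clock_law_def)

lemma sets_system_law [measurable_cong, simp]: "sets system_law = sets clock_space"
  unfolding system_law_def by (intro sets_PiM_cong) auto

lemma space_system_law [simp]: "space system_law = UNIV"
  unfolding system_law_def by (simp add: space_PiM)

sublocale system: prob_space system_law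
  unfolding system_law_def by (intro prob_space_PiM prob_space_clock_law)

lemma measurable_update_clock [measurable (raw)]:
  assumes "f \<in> borel_measurable N" "g \<in> N \<rightarrow>\<^sub>M clock_space"
  shows "(\<lambda>w. (g w)(i := f w)) \<in> N \<rightarrow>\<^sub>M clock_space"
proof (rule measurable_into_clock_space)
  fix j
  show "(\<lambda>w. ((g w)(i := f w)) j) \<in> borel_measurable N"
    using assms measurable_compose[OF assms(2) measurable_component_singleton[of j UNIV "\<lambda>_. borel"]]
    by (cases "j = i") auto
qed

text \<open>Under a product measure one may overwrite a coordinate by an independent copy. Resampling the clocks that
decide the first event takes the place of conditioning on them.\<close>

lemma nn_integral_resample:
  assumes [measurable]: "f \<in> borel_measurable clock_space"
  shows "(\<integral>\<^sup>+c. f c \<partial>system_law) = (\<integral>\<^sup>+d. (\<integral>\<^sup>+c. f (c(i := d)) \<partial>system_law) \<partial>clock_law i)"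
proof -
  have "system_law = distr (clock_law i \<Otimes>\<^sub>M system_law) system_law (\<lambda>(d, c). c(i := d))"
    using distr_pair_PiM_eq_PiM[of UNIV clock_law i, symmetric] prob_space_clock_law
    by (simp add: system_law_def)
  then have "(\<integral>\<^sup>+c. f c \<partial>system_law) =
      (\<integral>\<^sup>+c. f c \<partial>distr (clock_law i \<Otimes>\<^sub>M system_law) system_law (\<lambda>(d, c). c(i := d)))"
    by simp
  also have "\<dots> = (\<integral>\<^sup>+p. f (case p of (d, c) \<Rightarrow> c(i := d)) \<partial>(clock_law i \<Otimes>\<^sub>M system_law))"
    by (rule nn_integral_distr) measurable
  also have "\<dots> = (\<integral>\<^sup>+d. (\<integral>\<^sup>+c. f (c(i := d)) \<partial>system_law) \<partial>clock_law i)"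
    by (subst system.nn_integral_fst[symmetric]) (auto simp: case_prod_beta)
  finally show ?thesis .
qed

lemma nn_integral_resample2:
  assumes [measurable]: "f \<in> borel_measurable clock_space"
  shows "(\<integral>\<^sup>+c. f c \<partial>system_law) =
    (\<integral>\<^sup>+d. (\<integral>\<^sup>+t. (\<integral>\<^sup>+c. f (c(j := t, i := d)) \<partial>system_law) \<partial>clock_law j) \<partial>clock_law i)"
proof -
  have "(\<integral>\<^sup>+c. f (c(i := d)) \<partial>system_law) =
     (\<integral>\<^sup>+t. (\<integral>\<^sup>+c. f (c(j := t, i := d)) \<partial>system_law) \<partial>clock_law j)" for d
    by (rule nn_integral_resample) measurable
  then show ?thesis by (simp add: nn_integral_resample[OF assms, of i])
qed

text \<open>An injective renaming of clocks that respects the rates preserves the law. It is applied to the passage to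
a daughter and to the shift of flip clocks at the first flip.\<close>

lemma nn_integral_reindex:
  assumes "inj \<sigma>" and "\<And>i. clock_rate qp qm \<beta> (\<sigma> i) = clock_rate qp qm \<beta> i"
    and [measurable]: "f \<in> borel_measurable clock_space"
  shows "(\<integral>\<^sup>+c. f (\<lambda>i. c (\<sigma> i)) \<partial>system_law) = (\<integral>\<^sup>+c. f c \<partial>system_law)"
proof -
  have law: "clock_law (\<sigma> i) = clock_law i" for i
    by (simp add: clock_law_def assms)
  have "distr system_law system_law (\<lambda>c. \<lambda>i. c (\<sigma> i)) = system_law"
    using distr_PiM_reindex[of UNIV clock_law \<sigma> UNIV] prob_space_clock_law assms(1)
    by (simp add: system_law_def law restrict_UNIV)
  then have "(\<integral>\<^sup>+c. f c \<partial>system_law) = (\<integral>\<^sup>+c. f c \<partial>distr system_law system_law (\<lambda>c. \<lambda>i. c (\<sigma> i)))"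
    by simp
  also have "\<dots> = (\<integral>\<^sup>+c. f (\<lambda>i. c (\<sigma> i)) \<partial>system_law)"
  proof (rule nn_integral_distr)
    show "(\<lambda>c. \<lambda>i. c (\<sigma> i)) \<in> system_law \<rightarrow>\<^sub>M system_law"
      unfolding measurable_cong_sets[OF refl sets_system_law]
      by (rule measurable_into_clock_space) measurable
  qed measurable
  finally show ?thesis ..
qed

lemma indep_coordinates: "system.indep_vars (\<lambda>_. borel) (\<lambda>i c. c i) UNIV"
proof -
  have [simp]: "distr system_law borel (\<lambda>c. c i) = clock_law i" for i
    using distr_PiM_component[of UNIV clock_law i] prob_space_clock_law
    by (simp add: system_law_def cong: distr_cong)
  have "distr system_law clock_space (\<lambda>c. \<lambda>i\<in>UNIV. c i) = system_law"
    by (simp add: restrict_UNIV distr_id2)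
  also have "\<dots> = PiM UNIV (\<lambda>i. distr system_law borel (\<lambda>c. c i))"
    by (simp add: system_law_def[symmetric])
  finally show ?thesis
    by (subst system.indep_vars_iff_distr_eq_PiM) auto
qed

lemma daughter_law:
  assumes [measurable]: "A \<in> sets clock_space"
  shows "system.prob {c. daughter b c \<in> A} = system.prob A"
proof -
  have "inj (daughter_clock b)"
  proof (rule injI)
    fix i j assume "daughter_clock b i = daughter_clock b j"
    then show "i = j" by (cases i; cases j) auto
  qed
  moreover have "clock_rate qp qm \<beta> (daughter_clock b i) = clock_rate qp qm \<beta> i" for i
    by (cases i) auto
  ultimately have "(\<integral>\<^sup>+c. indicator A (daughter b c) \<partial>system_law) = (\<integral>\<^sup>+c. indicator A c \<partial>system_law)"
    unfolding daughter_def by (rule nn_integral_reindex) simp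
  moreover have "(\<lambda>c. indicator A (daughter b c) :: ennreal) = indicator {c. daughter b c \<in> A}"
    by (auto simp: indicator_def fun_eq_iff)
  moreover have "{c. daughter b c \<in> A} \<in> sets system_law"
    using measurable_sets[OF measurable_daughter assms, of b] by (simp add: vimage_def space_PiM)
  ultimately show ?thesis by (simp add: system.emeasure_eq_measure)
qed

text \<open>The progenies of the two daughters read disjoint sets of clocks.\<close>

lemma daughters_independent:
  assumes [measurable]: "A \<in> sets clock_space"
  shows "system.prob {c. daughter True c \<in> A \<and> daughter False c \<in> A} = (system.prob A)\<^sup>2"
proof -
  define I where "I b = range (daughter_clock b)" for b
  have disj: "I True \<inter> I False = {}"
  proof -
    have "daughter_clock True i \<noteq> daughter_clock False j" for i j by (cases i; cases j) auto
    then show ?thesis by (auto simp: I_def)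
  qed
  let ?r = "\<lambda>b c. restrict (\<lambda>i. c i) (I b)"
  let ?g = "\<lambda>b c. daughter b c"
  have "system.indep_var (PiM (I True) (\<lambda>_. borel)) (?r True) (PiM (I False) (\<lambda>_. borel)) (?r False)"
    using system.indep_var_restrict[OF indep_coordinates disj] by simp
  moreover have g: "?g b \<in> PiM (I b) (\<lambda>_. borel) \<rightarrow>\<^sub>M clock_space" for b
    unfolding daughter_def by (intro measurable_into_clock_space measurable_component_singleton) (auto simp: I_def)
  ultimately have "system.indep_var clock_space (?g True \<circ> ?r True) clock_space (?g False \<circ> ?r False)"
    by (intro system.indep_var_compose)
  moreover have "?g b \<circ> ?r b = ?g b" for b
    by (auto simp: fun_eq_iff daughter_def I_def)
  ultimately have "system.indep_var clock_space (?g True) clock_space (?g False)"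
    by simp
  from system.indep_varD[OF this assms assms]
  have "system.prob {c. daughter True c \<in> A \<and> daughter False c \<in> A} =
      system.prob {c. daughter True c \<in> A} * system.prob {c. daughter False c \<in> A}"
    by (simp add: vimage_def Int_def)
  then show ?thesis by (simp add: daughter_law power2_eq_square)
qed

lemma nn_integral_clock_law:
  assumes "g \<in> borel_measurable borel"
  shows "(\<integral>\<^sup>+t. g t \<partial>clock_law i) =
    (\<integral>\<^sup>+t. ennreal (exponential_density (clock_rate qp qm \<beta> i) t) * g t \<partial>lborel)"
  unfolding clock_law_def by (rule nn_integral_density) (use assms in auto)

text \<open>On the event that a clock exceeds \<open>t\<close>, the excess has the law of the whole clock.\<close>

lemma memoryless:
  assumes [measurable]: "g \<in> borel_measurable borel" and "0 \<le> t"
  shows "(\<integral>\<^sup>+d. indicator {t..} d * g (d - t) \<partial>clock_law i) =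
    ennreal (exp (- clock_rate qp qm \<beta> i * t)) * (\<integral>\<^sup>+d. g d \<partial>clock_law i)"
proof -
  let ?l = "clock_rate qp qm \<beta> i"
  have "(\<integral>\<^sup>+d. indicator {t..} d * g (d - t) \<partial>clock_law i) =
      (\<integral>\<^sup>+d. ennreal (exponential_density ?l d) * (indicator {t..} d * g (d - t)) \<partial>lborel)"
    unfolding clock_law_def by (rule nn_integral_density) measurable
  also have "\<dots> = (\<integral>\<^sup>+d. ennreal (exponential_density ?l (t + d)) * (indicator {t..} (t + d) * g d) \<partial>lborel)"
    by (subst nn_integral_real_affine[where c = 1 and t = t]) auto
  also have "\<dots> = (\<integral>\<^sup>+d. ennreal (exp (- ?l * t)) * (ennreal (exponential_density ?l d) * g d) \<partial>lborel)"
  proof (rule nn_integral_cong)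
    fix d
    have "exponential_density ?l (t + d) = exp (- ?l * t) * exponential_density ?l d" if "0 \<le> d"
      using that assms(2) by (simp add: exponential_density_def exp_add[symmetric] algebra_simps)
    then show "ennreal (exponential_density ?l (t + d)) * (indicator {t..} (t + d) * g d) =
        ennreal (exp (- ?l * t)) * (ennreal (exponential_density ?l d) * g d)"
      by (cases "0 \<le> d")
        (auto simp: indicator_def ennreal_mult' mult.assoc exponential_density_def[of _ d])
  qed
  also have "\<dots> = ennreal (exp (- ?l * t)) * (\<integral>\<^sup>+d. g d \<partial>clock_law i)"
    unfolding clock_law_def by (subst nn_integral_density) (auto simp: nn_integral_cmult)
  finally show ?thesis .
qed

section \<open>Regular clock values\<close>

lemma AE_clock_pos: "AE c in system_law. 0 < c i"
proof -
  have "AE x in clock_law i. 0 < x"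
    unfolding clock_law_def
    by (subst AE_density, simp, rule AE_mp[OF AE_lborel_singleton[of 0]])
      (auto simp: exponential_density_def)
  then show ?thesis
    unfolding system_law_def by (intro AE_PiM_component prob_space_clock_law) auto
qed

lemma exponential_laplace:
  "(\<integral>\<^sup>+x. ennreal (exp (- x)) \<partial>clock_law i) =
    ennreal (clock_rate qp qm \<beta> i / (clock_rate qp qm \<beta> i + 1))"
proof -
  let ?l = "clock_rate qp qm \<beta> i"
  have l: "0 < ?l" by (rule clock_rate_pos)
  have "(\<integral>\<^sup>+x. ennreal (exp (- x)) \<partial>clock_law i) =
      (\<integral>\<^sup>+x. ennreal (exponential_density ?l x) * ennreal (exp (- x)) \<partial>lborel)"
    by (rule nn_integral_clock_law) simp
  also have "\<dots> = (\<integral>\<^sup>+x. ennreal (?l / (?l + 1)) * ennreal (exponential_density (?l + 1) x) \<partial>lborel)"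
  proof (rule nn_integral_cong)
    fix x
    have e: "exp (- x * (?l + 1)) = exp (- x * ?l) * exp (- x)"
      by (simp add: exp_add[symmetric] algebra_simps)
    have "exponential_density ?l x * exp (- x) = ?l / (?l + 1) * exponential_density (?l + 1) x"
      unfolding exponential_density_def e using l by simp
    then show "ennreal (exponential_density ?l x) * ennreal (exp (- x)) =
        ennreal (?l / (?l + 1)) * ennreal (exponential_density (?l + 1) x)"
      using l by (simp add: ennreal_mult'[symmetric] exponential_density_nonneg)
  qed
  also have "\<dots> = ennreal (?l / (?l + 1)) * (\<integral>\<^sup>+x. ennreal (exponential_density (?l + 1) x) \<partial>lborel)"
    by (rule nn_integral_cmult) simp
  also have "(\<integral>\<^sup>+x. ennreal (exponential_density (?l + 1) x) \<partial>lborel) = 1"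
    using prob_space.emeasure_space_1[OF prob_space_exponential_density[of "?l + 1"]] l
    by (simp add: emeasure_density)
  finally show ?thesis by simp
qed

text \<open>The transform factorises by independence, and every factor \<open>q / (q + 1)\<close> is at most the one of the faster
type.\<close>

lemma flip_age_laplace:
  "(\<integral>\<^sup>+c. ennreal (exp (- flip_age s (flip_durations c u) n)) \<partial>system_law) \<le>
    ennreal ((max qp qm / (max qp qm + 1)) ^ n)"
proof -
  define i where "i k = Flip u (phase_type s k) k" for k
  have inj: "inj_on i {..<n}" by (auto simp: i_def inj_on_def)
  have "system.indep_vars (\<lambda>_. borel) (\<lambda>j c. c j) (i ` {..<n})"
    by (rule system.indep_vars_subset[OF indep_coordinates]) simp
  then have indep: "system.indep_vars (\<lambda>_. borel) (\<lambda>j c. ennreal (exp (- c j))) (i ` {..<n})"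
    by (rule system.indep_vars_compose2[where Y = "\<lambda>_ x. ennreal (exp (- x))"]) simp
  have "(\<integral>\<^sup>+c. ennreal (exp (- flip_age s (flip_durations c u) n)) \<partial>system_law) =
      (\<integral>\<^sup>+c. (\<Prod>j\<in>i ` {..<n}. ennreal (exp (- c j))) \<partial>system_law)"
    by (simp add: prod.reindex[OF inj]) (simp add: flip_age_def i_def sum_negf[symmetric] exp_sum prod_ennreal)
  also have "\<dots> = (\<Prod>j\<in>i ` {..<n}. \<integral>\<^sup>+c. ennreal (exp (- c j)) \<partial>system_law)"
    by (rule system.indep_vars_nn_integral) (use indep in auto)
  also have "\<dots> = (\<Prod>k<n. \<integral>\<^sup>+c. ennreal (exp (- c (i k))) \<partial>system_law)"
    by (simp add: prod.reindex[OF inj])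
  also have "\<dots> \<le> (\<Prod>k<n. ennreal (max qp qm / (max qp qm + 1)))"
  proof (rule prod_mono_ennreal)
    fix k
    have "distr system_law (clock_law (i k)) (\<lambda>c. c (i k)) = clock_law (i k)"
      using distr_PiM_component[of UNIV clock_law "i k"] prob_space_clock_law by (simp add: system_law_def)
    then have "(\<integral>\<^sup>+c. ennreal (exp (- c (i k))) \<partial>system_law) = (\<integral>\<^sup>+x. ennreal (exp (- x)) \<partial>clock_law (i k))"
      using nn_integral_distr[of "\<lambda>c. c (i k)" system_law "clock_law (i k)" "\<lambda>x. ennreal (exp (- x))"] by simp
    also have "\<dots> = ennreal (flip_rate (phase_type s k) / (flip_rate (phase_type s k) + 1))"
      by (simp add: exponential_laplace i_def)
    also have "\<dots> \<le> ennreal (max qp qm / (max qp qm + 1))"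
    proof (rule ennreal_leI)
      have "flip_rate r \<le> max qp qm" for r by (cases r) (auto simp: flip_rate_def)
      then show "flip_rate (phase_type s k) / (flip_rate (phase_type s k) + 1) \<le> max qp qm / (max qp qm + 1)"
        using flip_rate_pos[of "phase_type s k"] qp_pos by (auto simp: field_simps add_pos_pos)
    qed
    finally show "(\<integral>\<^sup>+c. ennreal (exp (- c (i k))) \<partial>system_law) \<le> ennreal (max qp qm / (max qp qm + 1))" .
  qed
  also have "\<dots> = ennreal ((max qp qm / (max qp qm + 1)) ^ n)"
    using qp_pos by (subst prod_ennreal) (auto simp: max_def)
  finally show ?thesis .
qed

text \<open>Markov's inequality for \<open>exp (- flip_age)\<close>: if all flip ages stay below \<open>a\<close>, this variable is at least
\<open>exp (- a)\<close>, while its mean decays geometrically in the number of flips.\<close>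

lemma AE_flip_age_exceeds: "AE c in system_law. \<exists>n. a < flip_age s (flip_durations c u) n"
proof -
  define \<rho> where "\<rho> = max qp qm / (max qp qm + 1)"
  have \<rho>: "0 \<le> \<rho>" "\<rho> < 1" using qp_pos by (auto simp: \<rho>_def max_def)
  let ?N = "{c. \<forall>n. flip_age s (flip_durations c u) n \<le> a}"
  have N: "?N \<in> sets clock_space"
  proof -
    have "Measurable.pred clock_space (\<lambda>c. \<forall>n. flip_age s (flip_durations c u) n \<le> a)" by measurable
    then show ?thesis by (simp add: pred_def space_PiM)
  qed
  have bound: "emeasure system_law ?N \<le> ennreal (exp a * \<rho> ^ n)" for n
  proof -
    have "emeasure system_law ?N = (\<integral>\<^sup>+c. indicator ?N c \<partial>system_law)" using N by simp
    also have "\<dots> \<le> (\<integral>\<^sup>+c. ennreal (exp a) * ennreal (exp (- flip_age s (flip_durations c u) n)) \<partial>system_law)"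
    proof (rule nn_integral_mono)
      fix c
      have "1 \<le> exp a * exp (- flip_age s (flip_durations c u) n)" if "c \<in> ?N"
        using that by (simp add: exp_add[symmetric])
      then show "indicator ?N c \<le> ennreal (exp a) * ennreal (exp (- flip_age s (flip_durations c u) n))"
        by (cases "c \<in> ?N") (simp_all add: ennreal_mult'[symmetric])
    qed
    also have "\<dots> = ennreal (exp a) * (\<integral>\<^sup>+c. ennreal (exp (- flip_age s (flip_durations c u) n)) \<partial>system_law)"
      by (rule nn_integral_cmult) simp
    also have "\<dots> \<le> ennreal (exp a) * ennreal (\<rho> ^ n)"
      unfolding \<rho>_def by (intro mult_left_mono flip_age_laplace) auto
    finally show ?thesis using \<rho> by (simp add: ennreal_mult'[symmetric])
  qed
  have "(\<lambda>n. ennreal (exp a * \<rho> ^ n)) \<longlonglongrightarrow> ennreal (exp a * 0)"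
    using \<rho> by (intro tendsto_ennrealI tendsto_mult tendsto_const LIMSEQ_realpow_zero)
  then have "emeasure system_law ?N \<le> ennreal (exp a * 0)"
    by (rule LIMSEQ_le_const) (use bound in auto)
  then have "emeasure system_law ?N = 0" by simp
  then show ?thesis
    by (intro AE_I[of _ _ ?N]) (use N in \<open>auto simp: not_less\<close>)
qed

theorem AE_regular: "AE c in system_law. regular c"
proof -
  have "AE c in system_law. \<forall>i. 0 < c i"
    unfolding AE_all_countable by (intro allI AE_clock_pos)
  moreover have "AE c in system_law. \<forall>u s (k::nat). \<exists>n. real k < flip_age s (flip_durations c u) n"
    unfolding AE_all_countable by (intro allI AE_flip_age_exceeds)
  ultimately show ?thesis
  proof eventually_elim
    case (elim c)
    have "\<exists>n. a < flip_age s (flip_durations c u) n" for u s a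
      using elim(2)[rule_format, of "nat \<lceil>a\<rceil>" s u] real_nat_ceiling_ge[of a] by (meson order.strict_trans1)
    then show ?case using elim(1) by (auto simp: regular_def less_imp_le)
  qed
qed

section \<open>The probability of reaching the negative half-line\<close>

definition hit_prob :: "nat \<Rightarrow> ptype \<Rightarrow> real \<Rightarrow> real" where
  "hit_prob n s x = system.prob {c. hits n s x c}"

lemma sets_hits [measurable]: "{c. hits n s x c} \<in> sets clock_space"
proof -
  have "Measurable.pred clock_space (hits n s x)" by measurable
  then show ?thesis by (simp add: pred_def space_PiM)
qed

lemma sets_daughter_hits: "{c. \<exists>b. hits n s x (daughter b c)} \<in> sets clock_space"
proof -
  have "Measurable.pred clock_space (\<lambda>c. \<exists>b. hits n s x (daughter b c))" by measurable
  then show ?thesis by (simp add: pred_def space_PiM)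
qed

lemma nn_integral_hits: "(\<integral>\<^sup>+c. indicator {c. hits n s x c} c \<partial>system_law) = ennreal (hit_prob n s x)"
  by (simp add: hit_prob_def system.emeasure_eq_measure)

lemma hit_prob_nonneg [simp]: "0 \<le> hit_prob n s x"
  by (simp add: hit_prob_def)

lemma hit_prob_le_1 [simp]: "hit_prob n s x \<le> 1"
  by (simp add: hit_prob_def)

text \<open>Measurability in the starting point, from the joint measurability of \<open>hits\<close> and Fubini.\<close>

lemma measurable_hit_prob [measurable]: "hit_prob n s \<in> borel_measurable borel"
proof -
  have "(\<lambda>x. \<integral>\<^sup>+c. indicator {c. hits n s x c} c \<partial>system_law) \<in> borel_measurable borel"
    by (rule system.borel_measurable_nn_integral) (simp add: indicator_def case_prod_beta)
  then have "(\<lambda>x. enn2real (ennreal (hit_prob n s x))) \<in> borel_measurable borel"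
    unfolding nn_integral_hits by measurable
  then show ?thesis by simp
qed

lemma hit_prob_neg: "x < 0 \<Longrightarrow> hit_prob n s x = 1"
  using system.prob_space by (simp add: hit_prob_def hits_neg)

lemma prob_daughter_hits:
  "system.prob {c. \<exists>b. hits n s x (daughter b c)} = 2 * hit_prob n s x - (hit_prob n s x)\<^sup>2"
proof -
  let ?A = "- {c. hits n s x c}"
  have [measurable]: "?A \<in> sets clock_space"
    using sets.compl_sets[OF sets_hits] by (simp add: space_PiM Compl_eq_Diff_UNIV)
  note [measurable] = sets_daughter_hits
  have "{c. daughter True c \<in> ?A \<and> daughter False c \<in> ?A} = UNIV - {c. \<exists>b. hits n s x (daughter b c)}"
    by (auto simp: ex_bool_eq)
  then have "1 - system.prob {c. \<exists>b. hits n s x (daughter b c)} = (system.prob ?A)\<^sup>2"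
    using daughters_independent[of ?A] system.prob_compl[of "{c. \<exists>b. hits n s x (daughter b c)}"]
    by simp
  moreover have "system.prob ?A = 1 - hit_prob n s x"
    using system.prob_compl[of "{c. hits n s x c}"] by (simp add: hit_prob_def Compl_eq_Diff_UNIV)
  ultimately show ?thesis by (simp add: power2_eq_square algebra_simps)
qed

lemma branching_prob_nonneg: "0 \<le> 2 * hit_prob n s x - (hit_prob n s x)\<^sup>2"
  using hit_prob_nonneg[of n s x] hit_prob_le_1[of n s x]
    mult_nonneg_nonneg[of "hit_prob n s x" "1 - hit_prob n s x"]
  unfolding power2_eq_square right_diff_distrib by linarith

lemma clock_survival:
  assumes "0 \<le> d"
  shows "(\<integral>\<^sup>+t. indicator {d<..} t \<partial>clock_law i) = ennreal (exp (- clock_rate qp qm \<beta> i * d))"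
proof -
  have "(\<integral>\<^sup>+t. indicator {d<..} t \<partial>clock_law i) = (\<integral>\<^sup>+t. indicator {d..} t * 1 \<partial>clock_law i)"
    unfolding clock_law_def
    by (rule nn_integral_cong_AE, subst AE_density, simp, rule AE_mp[OF AE_lborel_singleton[of d]])
      (auto simp: indicator_def)
  also have "\<dots> = ennreal (exp (- clock_rate qp qm \<beta> i * d))"
    using memoryless[of "\<lambda>_. 1" d i] assms prob_space.emeasure_space_1[OF prob_space_clock_law[of i]]
    by simp
  finally show ?thesis .
qed

text \<open>The intensity of success at the first event, if it takes place at \<open>x\<close> and \<open>p\<close> gives the chances of success
afterwards: a flip changes the type, and a death yields two independent attempts, one of which succeeds
with probability \<open>1 - (1 - p)\<^sup>2 = 2p - p\<^sup>2\<close>.\<close>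

definition first_event :: "(ptype \<Rightarrow> real \<Rightarrow> real) \<Rightarrow> ptype \<Rightarrow> real \<Rightarrow> real" where
  "first_event p s x = flip_rate s * p (flip_type s) x + \<beta> * (2 * p s x - (p s x)\<^sup>2)"

text \<open>Resampling the lifetime and the first flip clock separates them from the progeny of the daughters, which
does not read them. The flip clock exceeds the lifetime \<open>t\<close> with probability \<open>exp (- q t)\<close>.\<close>

lemma death_first:
  "(\<integral>\<^sup>+c. indicator {c. c (Death []) < c (Flip [] s 0) \<and>
       (\<exists>b. hits n s (x + velocity s * c (Death [])) (daughter b c))} c \<partial>system_law) =
   (\<integral>\<^sup>+t. ennreal (exp (- (flip_rate s + \<beta>) * t) * (\<beta> * (2 * hit_prob n s (x + velocity s * t)
       - (hit_prob n s (x + velocity s * t))\<^sup>2))) * indicator {0..} t \<partial>lborel)" (is "?L = ?R")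
proof -
  let ?D = "Death []" and ?F = "Flip [] s 0"
  let ?h = "\<lambda>y. 2 * hit_prob n s y - (hit_prob n s y)\<^sup>2"
  have h: "(\<integral>\<^sup>+c. indicator {c. \<exists>b. hits n s y (daughter b c)} c \<partial>system_law) = ennreal (?h y)" for y
    using sets_daughter_hits by (simp add: system.emeasure_eq_measure prob_daughter_hits)
  have daughter_upd: "daughter b (c(?F := t, ?D := d)) = daughter b c" for b c t d
  proof
    fix i show "daughter b (c(?F := t, ?D := d)) i = daughter b c i"
      by (cases i) (auto simp: daughter_def)
  qed
  have "?L = (\<integral>\<^sup>+d. (\<integral>\<^sup>+t. (\<integral>\<^sup>+c. indicator {d<..} t * indicator {c. \<exists>b. hits n s (x + velocity s * d) (daughter b c)} c
      \<partial>system_law) \<partial>clock_law ?F) \<partial>clock_law ?D)"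
    by (subst nn_integral_resample2[where i = ?D and j = ?F])
      (auto simp: daughter_upd indicator_def intro!: nn_integral_cong)
  also have "\<dots> = (\<integral>\<^sup>+d. (\<integral>\<^sup>+t. indicator {d<..} t * ennreal (?h (x + velocity s * d)) \<partial>clock_law ?F) \<partial>clock_law ?D)"
    by (simp add: nn_integral_cmult h sets_daughter_hits)
  also have "\<dots> = (\<integral>\<^sup>+d. (\<integral>\<^sup>+t. indicator {d<..} t \<partial>clock_law ?F) * ennreal (?h (x + velocity s * d)) \<partial>clock_law ?D)"
    by (simp add: nn_integral_multc)
  also have "\<dots> = (\<integral>\<^sup>+d. ennreal (exponential_density \<beta> d) *
     ((\<integral>\<^sup>+t. indicator {d<..} t \<partial>clock_law ?F) * ennreal (?h (x + velocity s * d))) \<partial>lborel)"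
  proof (subst nn_integral_clock_law)
    interpret F: prob_space "clock_law ?F" by (rule prob_space_clock_law)
    have *: "(\<lambda>(d, t). indicator {d<..} t :: ennreal) = (\<lambda>p. if fst p < snd p then 1 else 0)"
      by (auto simp: indicator_def fun_eq_iff)
    have "(\<lambda>d. \<integral>\<^sup>+t. indicator {d<..} t \<partial>clock_law ?F) \<in> borel_measurable borel"
      by (intro F.borel_measurable_nn_integral) (simp add: *)
    then show "(\<lambda>d. (\<integral>\<^sup>+t. indicator {d<..} t \<partial>clock_law ?F) * ennreal (?h (x + velocity s * d)))
        \<in> borel_measurable borel"
      by (rule borel_measurable_times_ennreal) measurable
  qed simp
  also have "\<dots> = ?R"
  proof (rule nn_integral_cong)
    fix d
    let ?z = "?h (x + velocity s * d)"
    have e: "exp (- (flip_rate s + \<beta>) * d) = exp (- flip_rate s * d) * exp (- d * \<beta>)"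
      by (simp add: exp_add[symmetric] algebra_simps)
    show "ennreal (exponential_density \<beta> d) *
       ((\<integral>\<^sup>+t. indicator {d<..} t \<partial>clock_law ?F) * ennreal ?z) =
      ennreal (exp (- (flip_rate s + \<beta>) * d) * (\<beta> * ?z)) * indicator {0..} d"
    proof (cases "0 \<le> d")
      case True
      have "ennreal (exponential_density \<beta> d) * (ennreal (exp (- flip_rate s * d)) * ennreal ?z) =
          ennreal (exponential_density \<beta> d * (exp (- flip_rate s * d) * ?z))"
        using branching_prob_nonneg[of n s] beta_pos
        by (simp add: ennreal_mult[symmetric] exponential_density_def)
      also have "exponential_density \<beta> d * (exp (- flip_rate s * d) * ?z) =
          exp (- (flip_rate s + \<beta>) * d) * (\<beta> * ?z)"
        unfolding e using True by (simp add: exponential_density_def mult_ac)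
      finally show ?thesis using True by (simp only: clock_survival clock_rate_Flip) simp
    qed (simp add: exponential_density_def)
  qed
  finally show ?thesis .
qed

lemma sets_flip_first:
  "{c. c (Flip [] s 0) \<le> c (Death []) \<and>
    hits n (flip_type s) (x + velocity s * c (Flip [] s 0)) (after_flip s c)} \<in> sets clock_space"
proof -
  have [measurable]: "Measurable.pred clock_space (\<lambda>c. c (Flip [] s 0) \<le> c (Death []))"
    unfolding not_less[symmetric] by measurable
  have "Measurable.pred clock_space (\<lambda>c. c (Flip [] s 0) \<le> c (Death []) \<and>
    hits n (flip_type s) (x + velocity s * c (Flip [] s 0)) (after_flip s c))"
    by measurable
  then show ?thesis by (simp add: pred_def space_PiM)
qed

text \<open>The flip clock is resampled outermost. For each of its values \<open>t\<close>, memorylessness of the lifetime turns the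
residual lifetime into a fresh one at the price of a factor \<open>exp (- \<beta> t)\<close>, so that the system after the
flip has the original law.\<close>

lemma flip_first:
  "(\<integral>\<^sup>+c. indicator {c. c (Flip [] s 0) \<le> c (Death []) \<and>
       hits n (flip_type s) (x + velocity s * c (Flip [] s 0)) (after_flip s c)} c \<partial>system_law) =
   (\<integral>\<^sup>+t. ennreal (exp (- (flip_rate s + \<beta>) * t) * (flip_rate s * hit_prob n (flip_type s) (x + velocity s * t)))
     * indicator {0..} t \<partial>lborel)" (is "?L = ?R")
proof -
  let ?D = "Death []" and ?F = "Flip [] s 0"
  let ?y = "\<lambda>t. x + velocity s * t"
  let ?H = "\<lambda>t c. indicator {c. hits n (flip_type s) (?y t) c} c :: ennreal"
  let ?G = "\<lambda>t d. \<integral>\<^sup>+c. ?H t (c(?D := d)) \<partial>system_law"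
  have [measurable]: "(\<lambda>c i. c (later_clock i)) \<in> clock_space \<rightarrow>\<^sub>M clock_space"
    by (rule measurable_into_clock_space) measurable
  have upd: "after_flip s (c(?D := d, ?F := t)) = (\<lambda>i. c (later_clock i))(?D := d - t)" for c t d
  proof
    fix i show "after_flip s (c(?D := d, ?F := t)) i = ((\<lambda>i. c (later_clock i))(?D := d - t)) i"
    proof (cases i)
      case (Death u) then show ?thesis by (cases u) auto
    next
      case (Flip u r k) then show ?thesis by (cases u) auto
    qed
  qed
  have inj: "inj later_clock"
  proof (rule injI)
    fix i j assume "later_clock i = later_clock j"
    then show "i = j"
      by (cases i rule: later_clock.cases; cases j rule: later_clock.cases) auto
  qed
  have rate: "clock_rate qp qm \<beta> (later_clock i) = clock_rate qp qm \<beta> i" for i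
    by (cases i rule: later_clock.cases) auto
  have "?L = (\<integral>\<^sup>+t. (\<integral>\<^sup>+d. (\<integral>\<^sup>+c. indicator {t..} d * ?H t ((\<lambda>i. c (later_clock i))(?D := d - t))
      \<partial>system_law) \<partial>clock_law ?D) \<partial>clock_law ?F)"
  proof (subst nn_integral_resample2[where i = ?F and j = ?D])
    show "indicator {c. c ?F \<le> c ?D \<and> hits n (flip_type s) (?y (c ?F)) (after_flip s c)}
        \<in> borel_measurable clock_space"
      by (rule borel_measurable_indicator) (rule sets_flip_first)
    have "indicator {c. c ?F \<le> c ?D \<and> hits n (flip_type s) (?y (c ?F)) (after_flip s c)}
        (c(?D := d, ?F := t)) = indicator {t..} d * ?H t ((\<lambda>i. c (later_clock i))(?D := d - t))" for c t d
      unfolding indicator_def mem_Collect_eq upd by simp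
    then show "(\<integral>\<^sup>+t. (\<integral>\<^sup>+d. (\<integral>\<^sup>+c. indicator {c. c ?F \<le> c ?D \<and>
        hits n (flip_type s) (?y (c ?F)) (after_flip s c)} (c(?D := d, ?F := t))
      \<partial>system_law) \<partial>clock_law ?D) \<partial>clock_law ?F) =
      (\<integral>\<^sup>+t. (\<integral>\<^sup>+d. (\<integral>\<^sup>+c. indicator {t..} d * ?H t ((\<lambda>i. c (later_clock i))(?D := d - t))
      \<partial>system_law) \<partial>clock_law ?D) \<partial>clock_law ?F)"
      by (simp only:)
  qed
  also have "\<dots> = (\<integral>\<^sup>+t. (\<integral>\<^sup>+d. indicator {t..} d * ?G t (d - t) \<partial>clock_law ?D) \<partial>clock_law ?F)"
  proof (intro nn_integral_cong)
    fix t d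
    have "(\<integral>\<^sup>+c. ?H t ((\<lambda>i. c (later_clock i))(?D := d - t)) \<partial>system_law) = ?G t (d - t)"
      using nn_integral_reindex[OF inj rate, of "\<lambda>c. ?H t (c(?D := d - t))"] by simp
    then show "(\<integral>\<^sup>+c. indicator {t..} d * ?H t ((\<lambda>i. c (later_clock i))(?D := d - t)) \<partial>system_law) =
        indicator {t..} d * ?G t (d - t)"
      by (subst nn_integral_cmult) simp_all
  qed
  also have "\<dots> = (\<integral>\<^sup>+t. ennreal (exponential_density (flip_rate s) t) *
      (\<integral>\<^sup>+d. indicator {t..} d * ?G t (d - t) \<partial>clock_law ?D) \<partial>lborel)"
  proof (subst nn_integral_clock_law)
    interpret D: prob_space "clock_law ?D" by (rule prob_space_clock_law)
    define K where "K p = ?G (fst p) (snd p)" for p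
    have "(\<lambda>(p, c). indicator {c. hits n (flip_type s) (?y (fst p)) c} (c(?D := snd p)) :: ennreal) =
        (\<lambda>q. if hits n (flip_type s) (?y (fst (fst q))) ((snd q)(?D := snd (fst q))) then 1 else 0)"
      by (auto simp: indicator_def fun_eq_iff)
    then have "K \<in> borel_measurable (borel \<Otimes>\<^sub>M borel)"
      unfolding K_def by (intro system.borel_measurable_nn_integral) simp
    then have [measurable]: "(\<lambda>w. K (f w, g w)) \<in> borel_measurable N"
      if "f \<in> borel_measurable N" "g \<in> borel_measurable N" for f g and N :: "(real \<times> real) measure"
      using measurable_compose[OF measurable_Pair[OF that]] by blast
    have "(\<lambda>(t, d). indicator {t..} d * ?G t (d - t)) =
        (\<lambda>q. if \<not> snd q < fst q then K (fst q, snd q - fst q) else 0)"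
      by (auto simp: indicator_def fun_eq_iff K_def)
    then show "(\<lambda>t. \<integral>\<^sup>+d. indicator {t..} d * ?G t (d - t) \<partial>clock_law ?D) \<in> borel_measurable borel"
      by (intro D.borel_measurable_nn_integral) simp
  qed simp
  also have "\<dots> = ?R"
  proof (rule nn_integral_cong)
    fix t
    have "(\<integral>\<^sup>+d. ?G t d \<partial>clock_law ?D) = ennreal (hit_prob n (flip_type s) (?y t))"
      using nn_integral_resample[of "?H t" ?D] nn_integral_hits[of n "flip_type s" "?y t"] by simp
    then have "(\<integral>\<^sup>+d. indicator {t..} d * ?G t (d - t) \<partial>clock_law ?D) =
        ennreal (exp (- \<beta> * t)) * ennreal (hit_prob n (flip_type s) (?y t))" if "0 \<le> t"
      using memoryless[of "?G t" t ?D] that by simp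
    then show "ennreal (exponential_density (flip_rate s) t) *
      (\<integral>\<^sup>+d. indicator {t..} d * ?G t (d - t) \<partial>clock_law ?D) = 
      ennreal (exp (- (flip_rate s + \<beta>) * t) * (flip_rate s * hit_prob n (flip_type s) (?y t)))
        * indicator {0..} t"
      using flip_rate_pos[of s]
      by (cases "0 \<le> t") (auto simp: exponential_density_def ennreal_mult'[symmetric] exp_add[symmetric]
        algebra_simps)
  qed
  finally show ?thesis .
qed

text \<open>One step of the recursion. The first event occurs at rate \<open>flip_rate s + \<beta>\<close>, along a straight run.\<close>

theorem hit_prob_Suc:
  assumes "0 \<le> x"
  shows "ennreal (hit_prob (Suc n) s x) = (\<integral>\<^sup>+t. ennreal (exp (- (flip_rate s + \<beta>) * t) *
    first_event (hit_prob n) s (x + velocity s * t)) * indicator {0..} t \<partial>lborel)"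
proof -
  let ?D = "Death []" and ?F = "Flip [] s 0"
  let ?A = "{c. c ?D < c ?F \<and> (\<exists>b. hits n s (x + velocity s * c ?D) (daughter b c))}"
  let ?B = "{c. c ?F \<le> c ?D \<and> hits n (flip_type s) (x + velocity s * c ?F) (after_flip s c)}"
  have "ennreal (hit_prob (Suc n) s x) = (\<integral>\<^sup>+c. indicator {c. hits (Suc n) s x c} c \<partial>system_law)"
    by (simp only: nn_integral_hits)
  also have "\<dots> = (\<integral>\<^sup>+c. indicator ?A c + indicator ?B c \<partial>system_law)"
    using assms by (intro nn_integral_cong) (auto simp: indicator_def)
  also have "\<dots> = (\<integral>\<^sup>+c. indicator ?A c \<partial>system_law) + (\<integral>\<^sup>+c. indicator ?B c \<partial>system_law)"
  proof (rule nn_integral_add)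
    have "Measurable.pred clock_space (\<lambda>c. c \<in> ?A)"
      unfolding mem_Collect_eq by measurable
    then have "?A \<in> sets clock_space" "?B \<in> sets clock_space"
      using sets_flip_first by (simp_all add: pred_def space_PiM)
    then show "indicator ?A \<in> borel_measurable system_law" "indicator ?B \<in> borel_measurable system_law"
      by simp_all
  qed
  also have "\<dots> = (\<integral>\<^sup>+t. ennreal (exp (- (flip_rate s + \<beta>) * t) *
    first_event (hit_prob n) s (x + velocity s * t)) * indicator {0..} t \<partial>lborel)"
    unfolding death_first flip_first
  proof (subst nn_integral_add[symmetric])
    have "ennreal (exp (- (flip_rate s + \<beta>) * t) * (\<beta> * (2 * hit_prob n s y - (hit_prob n s y)\<^sup>2))) +
       ennreal (exp (- (flip_rate s + \<beta>) * t) * (flip_rate s * hit_prob n (flip_type s) y)) =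
       ennreal (exp (- (flip_rate s + \<beta>) * t) * first_event (hit_prob n) s y)" for t y
      using branching_prob_nonneg[of n s y] beta_pos flip_rate_pos[of s]
      by (subst ennreal_plus[symmetric]) (auto simp: first_event_def algebra_simps)
    then show "(\<integral>\<^sup>+t. ennreal (exp (- (flip_rate s + \<beta>) * t) * (\<beta> * (2 * hit_prob n s (x + velocity s * t)
       - (hit_prob n s (x + velocity s * t))\<^sup>2))) * indicator {0..} t + 
       ennreal (exp (- (flip_rate s + \<beta>) * t) * (flip_rate s * hit_prob n (flip_type s) (x + velocity s * t)))
       * indicator {0..} t \<partial>lborel) = (\<integral>\<^sup>+t. ennreal (exp (- (flip_rate s + \<beta>) * t) *
      first_event (hit_prob n) s (x + velocity s * t)) * indicator {0..} t \<partial>lborel)"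
      by (intro nn_integral_cong) (simp add: distrib_right[symmetric])
  qed measurable
  finally show ?thesis .
qed

end

section \<open>A supersolution below the critical rate\<close>

lemma exponential_head_tail:
  fixes l x :: real
  assumes l: "0 < l" and x: "0 \<le> x"
  shows "(\<integral>\<^sup>+t. ennreal (exponential_density l t) * indicator {x..} t \<partial>lborel) = ennreal (exp (- l * x))"
    and "(\<integral>\<^sup>+t. ennreal (exponential_density l t) * indicator {..<x} t \<partial>lborel) = ennreal (1 - exp (- l * x))"
proof -
  let ?N = "density lborel (exponential_density l)"
  interpret N: prob_space ?N using l by (rule prob_space_exponential_density)
  have "(\<integral>\<^sup>+t. ennreal (exponential_density l t) * indicator {x..} t \<partial>lborel) =
     (\<integral>\<^sup>+t. ennreal (exponential_density l (x + t)) * indicator {x..} (x + t) \<partial>lborel)"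
    by (subst nn_integral_real_affine[where c = 1 and t = x]) auto
  also have "\<dots> = (\<integral>\<^sup>+t. ennreal (exp (- l * x)) * ennreal (exponential_density l t) \<partial>lborel)"
    using x by (intro nn_integral_cong)
      (auto simp: exponential_density_def indicator_def ennreal_mult'[symmetric] exp_add[symmetric] algebra_simps)
  also have "\<dots> = ennreal (exp (- l * x))"
    using N.emeasure_space_1 by (simp add: nn_integral_cmult emeasure_density)
  finally show tail: "(\<integral>\<^sup>+t. ennreal (exponential_density l t) * indicator {x..} t \<partial>lborel) = ennreal (exp (- l * x))" .
  have "emeasure ?N {x..} = ennreal (exp (- l * x))" using tail by (simp add: emeasure_density)
  then have "N.prob {x..} = exp (- l * x)" by (simp add: N.emeasure_eq_measure)
  moreover have "N.prob (UNIV - {x..}) = 1 - N.prob {x..}"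
    using N.prob_compl[of "{x..}"] by simp
  moreover have "UNIV - {x..} = {..<x}" by auto
  ultimately have "emeasure ?N {..<x} = ennreal (1 - exp (- l * x))" by (simp add: N.emeasure_eq_measure)
  then show "(\<integral>\<^sup>+t. ennreal (exponential_density l t) * indicator {..<x} t \<partial>lborel) = ennreal (1 - exp (- l * x))"
    by (simp add: emeasure_density)
qed

context branching_rates begin

text \<open>The union bound over the two daughters, which linearises the recursion.\<close>

lemma first_event_le:
  "first_event (hit_prob n) s x \<le> flip_rate s * hit_prob n (flip_type s) x + 2 * \<beta> * hit_prob n s x"
  using beta_pos by (simp add: first_event_def algebra_simps)

lemma first_event_neg: "x < 0 \<Longrightarrow> first_event (hit_prob n) s x = flip_rate s + \<beta>"
  by (simp add: first_event_def hit_prob_neg)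

text \<open>Induction shows that all iterates stay below a supersolution. Within the exponential ansatz, type \<open>+\<close> asks for
\<open>q\<^sub>+ + 2\<beta>\<rho> \<le> \<rho>(q\<^sub>+ + \<beta> - \<theta>)\<close>, that is \<open>\<theta> \<le> q\<^sub>+ - \<beta> - \<surd>(q\<^sub>+q\<^sub>-)\<close>, and type \<open>-\<close> asks for
\<open>q\<^sub>-\<rho> + 2\<beta> \<le> q\<^sub>- + \<beta> + \<theta>\<close>, that is \<open>\<theta> \<ge> \<beta> + \<surd>(q\<^sub>+q\<^sub>-) - q\<^sub>-\<close>. The \<open>\<theta>\<close> chosen here is the largest value
permitted by the first inequality; the second one is then the hypothesis on \<open>\<beta>\<close>.\<close>

lemma hit_prob_bound:
  assumes "\<beta> \<le> (1/2) * (sqrt qm - sqrt qp)\<^sup>2"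
  defines "\<rho> \<equiv> sqrt (qp / qm)" and "\<theta> \<equiv> qp - \<beta> - sqrt (qp * qm)"
  shows "0 \<le> x \<Longrightarrow> hit_prob n s x \<le> (case s of Plus \<Rightarrow> \<rho> | Minus \<Rightarrow> 1) * exp (\<theta> * x)"
proof (induction n arbitrary: s x)
  case 0
  have "hit_prob 0 s x = 0" using 0 by (simp add: hit_prob_def)
  moreover have "0 \<le> \<rho>" using qp_pos qm_pos by (simp add: \<rho>_def)
  ultimately show ?case by (cases s) auto
next
  case (Suc n)
  note x = \<open>0 \<le> x\<close>
  define m where "m = sqrt (qp * qm)"
  have m: "0 < m" using qp_pos qm_pos by (simp add: m_def)
  have qm\<rho>: "qm * \<rho> = m" and \<rho>m: "\<rho> * m = qp"
    using qp_pos qm_pos by (simp_all add: \<rho>_def m_def real_sqrt_divide real_sqrt_mult field_simps)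
  have \<rho>: "0 < \<rho>" using qp_pos qm_pos by (simp add: \<rho>_def)
  have "(sqrt qm - sqrt qp)\<^sup>2 = qm + qp - 2 * m"
    using qp_pos qm_pos by (simp add: power2_diff m_def real_sqrt_mult)
  then have crit: "2 * \<beta> \<le> qm + qp - 2 * m" using assms(1) by simp
  have \<theta>: "\<theta> = qp - \<beta> - m" by (simp add: \<theta>_def m_def)
  show ?case
  proof (cases s)
    case Plus
    define l where "l = qp + \<beta> - \<theta>"
    have l: "l = 2 * \<beta> + m" "0 < l" using m beta_pos by (auto simp: l_def \<theta>)
    have "ennreal (hit_prob (Suc n) s x) = (\<integral>\<^sup>+t. ennreal (exp (- (qp + \<beta>) * t) *
      first_event (hit_prob n) s (x + t)) * indicator {0..} t \<partial>lborel)"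
      using hit_prob_Suc[OF x, of n s] by (simp add: Plus flip_rate_def)
    also have "\<dots> \<le> (\<integral>\<^sup>+t. ennreal (\<rho> * exp (\<theta> * x)) * ennreal (exponential_density l t) \<partial>lborel)"
    proof (rule nn_integral_mono)
      fix t
      show "ennreal (exp (- (qp + \<beta>) * t) * first_event (hit_prob n) s (x + t)) * indicator {0..} t
        \<le> ennreal (\<rho> * exp (\<theta> * x)) * ennreal (exponential_density l t)"
      proof (cases "0 \<le> t")
        case True
        have "first_event (hit_prob n) s (x + t) \<le>
            qp * hit_prob n Minus (x + t) + 2 * \<beta> * hit_prob n Plus (x + t)"
          using first_event_le[of n s "x + t"] by (simp add: Plus flip_rate_def)
        also have "\<dots> \<le> qp * exp (\<theta> * (x + t)) + 2 * \<beta> * (\<rho> * exp (\<theta> * (x + t)))"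
          using Suc.IH[of "x + t" Minus] Suc.IH[of "x + t" Plus] x True qp_pos beta_pos
          by (intro add_mono mult_left_mono) auto
        also have "\<dots> = (\<rho> * l) * exp (\<theta> * (x + t))"
          using \<rho>m by (simp add: l(1) algebra_simps)
        finally have "exp (- (qp + \<beta>) * t) * first_event (hit_prob n) s (x + t) \<le>
            exp (- (qp + \<beta>) * t) * ((\<rho> * l) * exp (\<theta> * (x + t)))"
          by (rule mult_left_mono) simp
        also have "\<dots> = \<rho> * exp (\<theta> * x) * exponential_density l t"
        proof -
          have "exp (- (qp + \<beta>) * t) * exp (\<theta> * (x + t)) = exp (\<theta> * x) * exp (- t * l)"
            by (simp add: exp_add[symmetric] l_def algebra_simps)
          then show ?thesis using True by (simp add: exponential_density_def mult_ac)
        qed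
        finally show ?thesis
          using True \<rho> l(2) by (simp add: ennreal_mult[symmetric] exponential_density_nonneg ennreal_leI)
      qed simp
    qed
    also have "\<dots> = ennreal (\<rho> * exp (\<theta> * x))"
      using prob_space.emeasure_space_1[OF prob_space_exponential_density[OF l(2)]]
      by (simp add: nn_integral_cmult emeasure_density)
    finally show ?thesis using \<rho> by (simp add: Plus)
  next
    case Minus
    define l where "l = qm + \<beta> + \<theta>"
    have l: "m + 2 * \<beta> \<le> l" "0 < l" using m beta_pos crit by (auto simp: l_def \<theta>)
    have lam: "0 < qm + \<beta>" using qm_pos beta_pos by simp
    have "ennreal (hit_prob (Suc n) s x) = (\<integral>\<^sup>+t. ennreal (exp (- (qm + \<beta>) * t) *
      first_event (hit_prob n) s (x - t)) * indicator {0..} t \<partial>lborel)"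
      using hit_prob_Suc[OF x, of n s] by (simp add: Minus flip_rate_def)
    also have "\<dots> \<le> (\<integral>\<^sup>+t. ennreal (exp (\<theta> * x)) * (ennreal (exponential_density l t) * indicator {..x} t) +
        ennreal (exponential_density (qm + \<beta>) t) * indicator {x..} t \<partial>lborel)"
    proof (rule nn_integral_mono)
      fix t
      show "ennreal (exp (- (qm + \<beta>) * t) * first_event (hit_prob n) s (x - t)) * indicator {0..} t
        \<le> ennreal (exp (\<theta> * x)) * (ennreal (exponential_density l t) * indicator {..x} t) +
        ennreal (exponential_density (qm + \<beta>) t) * indicator {x..} t"
      proof (cases "0 \<le> t")
        case t: True
        show ?thesis
        proof (cases "t \<le> x")
          case True
          have "first_event (hit_prob n) s (x - t) \<le>
              qm * hit_prob n Plus (x - t) + 2 * \<beta> * hit_prob n Minus (x - t)"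
            using first_event_le[of n s "x - t"] by (simp add: Minus flip_rate_def)
          also have "\<dots> \<le> qm * (\<rho> * exp (\<theta> * (x - t))) + 2 * \<beta> * exp (\<theta> * (x - t))"
            using Suc.IH[of "x - t" Minus] Suc.IH[of "x - t" Plus] True qm_pos beta_pos
            by (intro add_mono mult_left_mono) auto
          also have "\<dots> = (m + 2 * \<beta>) * exp (\<theta> * (x - t))"
            using qm\<rho> by (simp add: algebra_simps flip: mult.assoc)
          also have "\<dots> \<le> l * exp (\<theta> * (x - t))"
            using l(1) by (intro mult_right_mono) auto
          finally have "exp (- (qm + \<beta>) * t) * first_event (hit_prob n) s (x - t) \<le>
              exp (- (qm + \<beta>) * t) * (l * exp (\<theta> * (x - t)))"
            by (rule mult_left_mono) simp
          also have "\<dots> = exp (\<theta> * x) * exponential_density l t"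
          proof -
            have "exp (- (qm + \<beta>) * t) * exp (\<theta> * (x - t)) = exp (\<theta> * x) * exp (- t * l)"
              by (simp add: exp_add[symmetric] l_def algebra_simps)
            then show ?thesis using t by (simp add: exponential_density_def mult_ac)
          qed
          finally have "ennreal (exp (- (qm + \<beta>) * t) * first_event (hit_prob n) s (x - t)) \<le>
              ennreal (exp (\<theta> * x)) * ennreal (exponential_density l t)"
            using l(2) by (simp add: ennreal_mult[symmetric] exponential_density_nonneg ennreal_leI)
          then show ?thesis using True t by (simp add: add_increasing2)
        next
          \<comment> \<open>Beyond \<open>x\<close> the run has entered the negative half-line, where the exact value of the source is
            needed: the union bound would be too large there by \<open>\<beta>\<close>.\<close>
          case False
          then show ?thesis using t x
            by (simp add: first_event_neg Minus flip_rate_def exponential_density_def algebra_simps)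
        qed
      qed simp
    qed
    also have "\<dots> = ennreal (exp (\<theta> * x)) * (\<integral>\<^sup>+t. ennreal (exponential_density l t) * indicator {..<x} t \<partial>lborel)
      + (\<integral>\<^sup>+t. ennreal (exponential_density (qm + \<beta>) t) * indicator {x..} t \<partial>lborel)"
    proof -
      have "(\<integral>\<^sup>+t. ennreal (exponential_density l t) * indicator {..x} t \<partial>lborel) =
          (\<integral>\<^sup>+t. ennreal (exponential_density l t) * indicator {..<x} t \<partial>lborel)"
        by (rule nn_integral_cong_AE, rule AE_mp[OF AE_lborel_singleton[of x]]) (auto simp: indicator_def)
      then show ?thesis by (subst nn_integral_add) (auto simp: nn_integral_cmult)
    qed
    also have "\<dots> = ennreal (exp (\<theta> * x) * (1 - exp (- l * x)) + exp (- (qm + \<beta>) * x))"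
      unfolding exponential_head_tail(1)[OF lam x] exponential_head_tail(2)[OF l(2) x]
      using l(2) x by (simp add: ennreal_mult[symmetric] ennreal_plus[symmetric] del: ennreal_plus)
    also have "exp (\<theta> * x) * (1 - exp (- l * x)) + exp (- (qm + \<beta>) * x) = exp (\<theta> * x)"
    proof -
      have "exp (\<theta> * x) * exp (- l * x) = exp (- (qm + \<beta>) * x)"
        by (simp add: exp_add[symmetric] l_def algebra_simps)
      then show ?thesis by (simp add: right_diff_distrib)
    qed
    finally show ?thesis by (simp add: Minus)
  qed
qed

end

section \<open>The integral equation for infinitely many events\<close>

lemma hits_mono_steps: "hits n s x c \<Longrightarrow> hits (Suc n) s x c"
proof (induction n arbitrary: s x c)
  case (Suc n)
  show ?case
    using Suc.prems[unfolded hits.simps(2)] Suc.IH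
    by (subst hits.simps(2)) (auto split: if_splits simp del: hits.simps)
qed simp

lemma hits_antimono: "hits n s y c \<Longrightarrow> x \<le> y \<Longrightarrow> hits n s x c"
proof (induction n arbitrary: s x y c)
  case (Suc n)
  then show ?case
    by (auto split: if_splits) (meson add_right_mono)+
qed simp

context branching_rates begin

definition reach_prob :: "ptype \<Rightarrow> real \<Rightarrow> real" where
  "reach_prob s x = system.prob {c. \<exists>n. hits n s x c}"

lemma sets_ex_hits: "{c. \<exists>n. hits n s x c} \<in> sets clock_space"
proof -
  have "Measurable.pred clock_space (\<lambda>c. \<exists>n. hits n s x c)" by measurable
  then show ?thesis by (simp add: pred_def space_PiM)
qed

lemma reach_prob_range: "0 \<le> reach_prob s x" "reach_prob s x \<le> 1"
  by (auto simp: reach_prob_def)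

lemma antimono_reach_prob: "antimono (reach_prob s)"
  unfolding reach_prob_def
  by (intro antimonoI system.finite_measure_mono) (auto intro: hits_antimono sets_ex_hits)

lemma reach_prob_neg: "x < 0 \<Longrightarrow> reach_prob s x = 1"
  using system.prob_space by (simp add: reach_prob_def hits_neg)

lemma hit_prob_mono: "hit_prob n s x \<le> hit_prob (Suc n) s x"
  unfolding hit_prob_def by (intro system.finite_measure_mono) (auto intro: hits_mono_steps simp del: hits.simps)

lemma hit_prob_tendsto: "(\<lambda>n. hit_prob n s x) \<longlonglongrightarrow> reach_prob s x"
proof -
  have "incseq (\<lambda>n. {c. hits n s x c})"
    by (intro incseq_SucI) (auto intro: hits_mono_steps simp del: hits.simps)
  then have "(\<lambda>n. system.prob {c. hits n s x c}) \<longlonglongrightarrow> system.prob (\<Union>n. {c. hits n s x c})"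
    by (intro system.finite_Lim_measure_incseq) auto
  moreover have "(\<Union>n. {c. hits n s x c}) = {c. \<exists>n. hits n s x c}" by auto
  ultimately show ?thesis by (simp add: hit_prob_def reach_prob_def)
qed

lemma measurable_reach_prob [measurable]: "reach_prob s \<in> borel_measurable borel"
  by (rule borel_measurable_LIMSEQ_real[OF hit_prob_tendsto]) simp

lemma branching_mono:
  fixes p q :: real
  assumes "p \<le> q" "q \<le> 1"
  shows "2 * p - p\<^sup>2 \<le> 2 * q - q\<^sup>2"
proof -
  have "0 \<le> (q - p) * (2 - p - q)" using assms by (intro mult_nonneg_nonneg) auto
  then show ?thesis by (simp add: power2_eq_square algebra_simps)
qed

lemma first_event_hit_prob_mono: "first_event (hit_prob n) s x \<le> first_event (hit_prob (Suc n)) s x"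
  unfolding first_event_def using flip_rate_pos[of s] beta_pos
  by (intro add_mono mult_left_mono hit_prob_mono branching_mono) auto

text \<open>Monotone convergence in \<open>hit_prob_Suc\<close>, using that \<open>2p - p\<^sup>2\<close> increases for \<open>p \<le> 1\<close>.\<close>

theorem reach_prob_eq:
  assumes "0 \<le> x"
  shows "ennreal (reach_prob s x) = (\<integral>\<^sup>+t. ennreal (exp (- (flip_rate s + \<beta>) * t) *
    first_event reach_prob s (x + velocity s * t)) * indicator {0..} t \<partial>lborel)"
proof (rule LIMSEQ_unique)
  show "(\<lambda>n. ennreal (hit_prob (Suc n) s x)) \<longlonglongrightarrow> ennreal (reach_prob s x)"
    by (intro tendsto_ennrealI LIMSEQ_Suc hit_prob_tendsto)
  let ?f = "\<lambda>p t. ennreal (exp (- (flip_rate s + \<beta>) * t) *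
    first_event p s (x + velocity s * t)) * indicator {0..} t"
  have "(\<lambda>n. \<integral>\<^sup>+t. ?f (hit_prob n) t \<partial>lborel) \<longlonglongrightarrow> (\<integral>\<^sup>+t. ?f reach_prob t \<partial>lborel)"
  proof (rule nn_integral_LIMSEQ)
    show "incseq (\<lambda>n. ?f (hit_prob n))"
      by (intro incseq_SucI le_funI mult_right_mono ennreal_leI mult_left_mono first_event_hit_prob_mono) auto
    show "?f (hit_prob n) \<in> borel_measurable lborel" for n
      unfolding first_event_def by measurable
    show "(\<lambda>n. ?f (hit_prob n) t) \<longlonglongrightarrow> ?f reach_prob t" for t
    proof -
      have "(\<lambda>n. ennreal (exp (- (flip_rate s + \<beta>) * t) * first_event (hit_prob n) s (x + velocity s * t)))
        \<longlonglongrightarrow> ennreal (exp (- (flip_rate s + \<beta>) * t) * first_event reach_prob s (x + velocity s * t))"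
        unfolding first_event_def by (intro tendsto_intros tendsto_ennrealI hit_prob_tendsto)
      then show ?thesis by (cases "0 \<le> t") simp_all
    qed
  qed
  then show "(\<lambda>n. ennreal (hit_prob (Suc n) s x)) \<longlonglongrightarrow> (\<integral>\<^sup>+t. ?f reach_prob t \<partial>lborel)"
    by (simp add: hit_prob_Suc[OF assms])
qed

end

section \<open>From the integral equation to differential equations\<close>

lemma velocity_square [simp]: "velocity s * velocity s = 1" "velocity s * (velocity s * t) = t"
  by (cases s; simp)+

lemma ennreal_add_eq_diff:
  assumes "I + ennreal b = ennreal a" "0 \<le> a" "0 \<le> b"
  shows "I = ennreal (a - b) \<and> b \<le> a"
proof -
  have "I < top" using assms(1) by (metis ennreal_add_eq_top ennreal_neq_top less_top)
  then obtain i where i: "I = ennreal i" "0 \<le> i" by (cases I) auto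
  then have "i + b = a" using assms by (simp add: ennreal_plus[symmetric] del: ennreal_plus)
  then show ?thesis using i by auto
qed

context branching_rates begin

lemma first_event_reach_nonneg: "0 \<le> first_event reach_prob s x"
proof -
  have "(reach_prob s x)\<^sup>2 \<le> 2 * reach_prob s x"
    using branching_mono[of 0 "reach_prob s x"] reach_prob_range by simp
  then show ?thesis using flip_rate_pos[of s] beta_pos reach_prob_range by (simp add: first_event_def)
qed

lemma measurable_first_event [measurable]: "first_event reach_prob s \<in> borel_measurable borel"
  unfolding first_event_def by measurable

text \<open>The exponential weight turns the integral along a run from \<open>x\<close> into the integral of a fixed function over a
half-line with end point \<open>x\<close>.\<close>

definition tilted_source :: "ptype \<Rightarrow> real \<Rightarrow> real" where
  "tilted_source s y = exp (- velocity s * (flip_rate s + \<beta>) * y) * first_event reach_prob s y"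

definition tilted_reach :: "ptype \<Rightarrow> real \<Rightarrow> real" where
  "tilted_reach s x = exp (- velocity s * (flip_rate s + \<beta>) * x) * reach_prob s x"

lemma tilted_source_nonneg: "0 \<le> tilted_source s y"
  by (simp add: tilted_source_def first_event_reach_nonneg)

lemma tilted_reach_nonneg: "0 \<le> tilted_reach s y"
  by (simp add: tilted_reach_def reach_prob_range)

lemma measurable_tilted_source [measurable]: "tilted_source s \<in> borel_measurable borel"
  unfolding tilted_source_def by measurable

text \<open>Substituting \<open>y = x + v t\<close> in the integral equation. The half-line is \<open>{x..}\<close> for type \<open>+\<close> and \<open>{..x}\<close> for type \<open>-\<close>.\<close>

lemma tilted_reach_eq:
  assumes "0 \<le> x"
  shows "ennreal (tilted_reach s x) =
    (\<integral>\<^sup>+y. ennreal (tilted_source s y) * indicator {y. 0 \<le> velocity s * (y - x)} y \<partial>lborel)"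
proof -
  let ?v = "velocity s" and ?l = "flip_rate s + \<beta>"
  have [measurable]: "{y. 0 \<le> ?v * (y - x)} \<in> sets borel" by measurable
  have "(\<integral>\<^sup>+y. ennreal (tilted_source s y) * indicator {y. 0 \<le> ?v * (y - x)} y \<partial>lborel) =
    (\<integral>\<^sup>+t. ennreal (tilted_source s (x + ?v * t)) * indicator {y. 0 \<le> ?v * (y - x)} (x + ?v * t) \<partial>lborel)"
    by (subst nn_integral_real_affine[where c = ?v and t = x]) (auto, cases s, auto)
  also have "\<dots> = (\<integral>\<^sup>+t. ennreal (exp (- ?v * ?l * x)) * (ennreal (exp (- ?l * t) *
    first_event reach_prob s (x + ?v * t)) * indicator {0..} t) \<partial>lborel)"
  proof (rule nn_integral_cong)
    fix t
    have "- ?v * ?l * (x + ?v * t) = - ?v * ?l * x + - ?l * t"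
      by (cases s) (auto simp: algebra_simps)
    then have "tilted_source s (x + ?v * t) =
        exp (- ?v * ?l * x) * (exp (- ?l * t) * first_event reach_prob s (x + ?v * t))"
      unfolding tilted_source_def by (simp only: exp_add mult.assoc)
    then show "ennreal (tilted_source s (x + ?v * t)) * indicator {y. 0 \<le> ?v * (y - x)} (x + ?v * t) =
      ennreal (exp (- ?v * ?l * x)) * (ennreal (exp (- ?l * t) *
        first_event reach_prob s (x + ?v * t)) * indicator {0..} t)"
      by (simp only: ennreal_mult'[OF exp_ge_zero]) (auto simp: indicator_def)
  qed
  also have "\<dots> = ennreal (exp (- ?v * ?l * x)) * ennreal (reach_prob s x)"
    unfolding reach_prob_eq[OF assms, of s] by (rule nn_integral_cmult) measurable
  finally show ?thesis
    by (simp add: tilted_reach_def ennreal_mult'[symmetric])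
qed

text \<open>The half-lines with end points \<open>0\<close> and \<open>x\<close> differ by the interval between them; \<open>velocity s\<close> records which
of the two is the larger.\<close>

lemma tilted_source_has_integral:
  assumes x: "0 \<le> x"
  shows "(tilted_source s has_integral velocity s * (tilted_reach s 0 - tilted_reach s x)) {0..x}"
proof -
  let ?f = "\<lambda>y. ennreal (tilted_source s y)"
  let ?I = "\<integral>\<^sup>+y. ?f y * indicator {0..x} y \<partial>lborel"
  let ?d = "velocity s * (tilted_reach s 0 - tilted_reach s x)"
  have [measurable]: "{y :: real. 0 \<le> velocity s * (y - z)} \<in> sets borel" for z by measurable
  have "?I = ennreal ?d \<and> 0 \<le> ?d"
  proof (cases s)
    case Plus
    have "?I + ennreal (tilted_reach s x) =
      (\<integral>\<^sup>+y. ?f y * indicator {0..x} y + ?f y * indicator {y. 0 \<le> velocity s * (y - x)} y \<partial>lborel)"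
      unfolding tilted_reach_eq[OF x] by (rule nn_integral_add[symmetric]) simp_all
    also have "\<dots> = (\<integral>\<^sup>+y. ?f y * indicator {y. 0 \<le> velocity s * (y - 0)} y \<partial>lborel)"
      by (rule nn_integral_cong_AE, rule AE_mp[OF AE_lborel_singleton[of x]])
        (use x in \<open>auto simp: indicator_def Plus\<close>)
    also have "\<dots> = ennreal (tilted_reach s 0)" by (rule tilted_reach_eq[symmetric]) simp
    finally show ?thesis
      using ennreal_add_eq_diff[OF _ tilted_reach_nonneg tilted_reach_nonneg] by (simp add: Plus)
  next
    case Minus
    have "?I + ennreal (tilted_reach s 0) =
      (\<integral>\<^sup>+y. ?f y * indicator {0..x} y + ?f y * indicator {y. 0 \<le> velocity s * (y - 0)} y \<partial>lborel)"
      unfolding tilted_reach_eq[OF order_refl] by (rule nn_integral_add[symmetric]) simp_all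
    also have "\<dots> = (\<integral>\<^sup>+y. ?f y * indicator {y. 0 \<le> velocity s * (y - x)} y \<partial>lborel)"
      by (rule nn_integral_cong_AE, rule AE_mp[OF AE_lborel_singleton[of 0]])
        (use x in \<open>auto simp: indicator_def Minus\<close>)
    also have "\<dots> = ennreal (tilted_reach s x)" by (rule tilted_reach_eq[OF x, symmetric])
    finally show ?thesis
      using ennreal_add_eq_diff[OF _ tilted_reach_nonneg tilted_reach_nonneg] by (simp add: Minus)
  qed
  then have "((\<lambda>y. tilted_source s y * indicator {0..x} y) has_integral ?d) UNIV"
    using tilted_source_nonneg
    by (intro nn_integral_has_integral) (auto simp: ennreal_mult' ennreal_indicator)
  moreover have "(\<lambda>y. tilted_source s y * indicator {0..x} y) =
      (\<lambda>y. if y \<in> {0..x} then tilted_source s y else 0)"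
    by (auto simp: indicator_def)
  ultimately show ?thesis by (simp only: has_integral_restrict_UNIV)
qed

lemma reach_prob_eq_integral:
  assumes "0 \<le> x"
  shows "reach_prob s x = exp (velocity s * (flip_rate s + \<beta>) * x) *
    (tilted_reach s 0 - velocity s * integral {0..x} (tilted_source s))"
proof -
  have "tilted_reach s 0 - velocity s * integral {0..x} (tilted_source s) = tilted_reach s x"
    using integral_unique[OF tilted_source_has_integral[OF assms, of s]] by simp
  then show ?thesis
    by (simp add: tilted_reach_def mult.assoc[symmetric] exp_add[symmetric])
qed

lemma continuous_on_reach_prob: "continuous_on {0..X} (reach_prob s)"
proof -
  have "continuous_on {0..X} (\<lambda>x. exp (velocity s * (flip_rate s + \<beta>) * x) *
    (tilted_reach s 0 - velocity s * integral {0..x} (tilted_source s)))"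
  proof (cases "0 \<le> X")
    case True
    show ?thesis
      by (intro continuous_intros indefinite_integral_continuous_1
        has_integral_integrable[OF tilted_source_has_integral[OF True]])
  qed simp
  then show ?thesis
    by (rule continuous_on_eq) (simp add: reach_prob_eq_integral[symmetric])
qed

text \<open>Regularity by bootstrapping: as the indefinite integral of a bounded function \<open>reach_prob\<close> is continuous,
so the integrand is continuous, and the fundamental theorem of calculus applies.\<close>

theorem reach_prob_deriv:
  assumes "0 < x"
  shows "(reach_prob s has_real_derivative
    velocity s * ((flip_rate s + \<beta>) * reach_prob s x - first_event reach_prob s x)) (at x)"
proof -
  let ?v = "velocity s" and ?l = "flip_rate s + \<beta>"
  let ?J = "\<lambda>y. integral {0..y} (tilted_source s)"
  have "continuous_on {0..x + 1} (tilted_source s)"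
    unfolding tilted_source_def first_event_def
    by (intro continuous_intros continuous_on_reach_prob)
  then have "(?J has_real_derivative tilted_source s x) (at x within {0..x + 1})"
    by (rule integral_has_real_derivative) (use assms in simp)
  then have J: "(?J has_real_derivative tilted_source s x) (at x)"
    using at_within_Icc_at[of 0 x "x + 1"] assms by simp
  have E: "((\<lambda>y. exp (?v * ?l * y)) has_real_derivative ?v * ?l * exp (?v * ?l * x)) (at x)"
    by (auto intro!: derivative_eq_intros)
  have D: "((\<lambda>y. exp (?v * ?l * y) * (tilted_reach s 0 - ?v * ?J y)) has_real_derivative
      ?v * ?l * exp (?v * ?l * x) * (tilted_reach s 0 - ?v * ?J x) +
      (0 - ?v * tilted_source s x) * exp (?v * ?l * x)) (at x)"
    by (intro DERIV_mult E DERIV_diff DERIV_cmult J DERIV_const)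
  have ev: "\<forall>\<^sub>F y in nhds x. reach_prob s y = exp (?v * ?l * y) * (tilted_reach s 0 - ?v * ?J y)"
    using eventually_nhds_in_open[of "{0<..}" x] assms
    by (auto elim!: eventually_mono intro!: reach_prob_eq_integral)
  have "?v * ?l * exp (?v * ?l * x) * (tilted_reach s 0 - ?v * ?J x) +
      (0 - ?v * tilted_source s x) * exp (?v * ?l * x) =
      ?v * (?l * (exp (?v * ?l * x) * (tilted_reach s 0 - ?v * ?J x)) - tilted_source s x * exp (?v * ?l * x))"
    by (simp add: algebra_simps)
  also have "exp (?v * ?l * x) * (tilted_reach s 0 - ?v * ?J x) = reach_prob s x"
    using reach_prob_eq_integral[of x s] assms by simp
  also have "tilted_source s x * exp (?v * ?l * x) = first_event reach_prob s x"
    by (simp add: tilted_source_def exp_minus)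
  finally show ?thesis
    using D DERIV_cong_ev[OF refl ev refl] by simp
qed

text \<open>From \<open>0\<close> a particle of type \<open>-\<close> is immediately to the left of \<open>0\<close>: on the whole run the source has its
maximal value \<open>q\<^sub>- + \<beta>\<close>.\<close>

lemma reach_prob_Minus_0: "reach_prob Minus 0 = 1"
proof -
  let ?l = "qm + \<beta>"
  have l: "0 < ?l" using qm_pos beta_pos by simp
  have "ennreal (reach_prob Minus 0) = (\<integral>\<^sup>+t. ennreal (exponential_density ?l t) \<partial>lborel)"
    unfolding reach_prob_eq[OF order_refl]
    by (rule nn_integral_cong_AE, rule AE_mp[OF AE_lborel_singleton[of 0]])
      (auto simp: exponential_density_def first_event_def reach_prob_neg flip_rate_def indicator_def algebra_simps)
  also have "\<dots> = 1"
    using prob_space.emeasure_space_1[OF prob_space_exponential_density[OF l]] by (simp add: emeasure_density)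
  finally show ?thesis by (simp add: reach_prob_range)
qed

text \<open>For type \<open>-\<close> the half-line \<open>{..x}\<close> grows with \<open>x\<close>, so \<open>tilted_reach\<close> stays above its value \<open>1\<close> at \<open>0\<close>.\<close>

lemma reach_prob_Minus_pos:
  assumes "0 \<le> x" shows "0 < reach_prob Minus x"
proof -
  have "ennreal (tilted_reach Minus 0) \<le> ennreal (tilted_reach Minus x)"
    by (subst (1 2) tilted_reach_eq)
      (use assms in \<open>auto simp: indicator_def intro!: nn_integral_mono mult_left_mono\<close>)
  then have "1 \<le> tilted_reach Minus x"
    by (simp add: tilted_reach_def reach_prob_Minus_0 reach_prob_range)
  then have "tilted_reach Minus x \<noteq> 0" by linarith
  then show ?thesis using reach_prob_range(1)[of Minus x] by (auto simp: tilted_reach_def less_le)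
qed

end

section \<open>Monotone solutions above the critical rate\<close>

text \<open>For \<open>y = 0\<close> the quadratic in \<open>r\<close> has no real root if \<open>2\<beta>\<close> lies strictly between \<open>(\<surd>q\<^sub>- - \<surd>q\<^sub>+)\<^sup>2\<close> and
\<open>(\<surd>q\<^sub>- + \<surd>q\<^sub>+)\<^sup>2\<close>, and only negative ones if \<open>2\<beta>\<close> is at least the latter. In either case it is bounded below on \<open>r \<ge> 0\<close> by a
multiple of \<open>1 + r\<^sup>2\<close>, with room for a small perturbation of the linear coefficient.\<close>

lemma discriminant_bound:
  fixes qp qm \<beta> :: real
  assumes "0 < qp" "0 < qm" and "(1/2) * (sqrt qm - sqrt qp)\<^sup>2 < \<beta>"
  shows "\<exists>e>0. \<exists>k>0. \<forall>r\<ge>0. \<forall>y\<le>e. k * (1 + r\<^sup>2) \<le> qp * r\<^sup>2 - (qp + qm - 2 * \<beta>) * r + qm - y * r"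
proof -
  define m where "m = sqrt qp * sqrt qm"
  define S where "S = qp + qm - 2 * \<beta>"
  have m: "0 < m" using assms by (simp add: m_def)
  have "(sqrt qm - sqrt qp)\<^sup>2 = qm + qp - 2 * m"
    using assms by (simp add: power2_diff m_def)
  then have S: "S < 2 * m" using assms(3) by (simp add: S_def)
  define e where "e = m - S / 2"
  \<comment> \<open>The fraction of the square-completing cross term \<open>2 m r \<le> qp r\<^sup>2 + qm\<close> that the linear
    coefficient uses up; the rest of the quadratic bounds \<open>1 + r\<^sup>2\<close>. It is set to \<open>0\<close> if that coefficient helps.\<close>
  define \<theta> where "\<theta> = max 0 ((S + e) / (2 * m))"
  define k where "k = (1 - \<theta>) * min qp qm"
  have e: "0 < e" using S by (simp add: e_def)
  have "S + e < 2 * m" using S unfolding e_def by linarith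
  then have \<theta>: "0 \<le> \<theta>" "\<theta> < 1" using m by (auto simp: \<theta>_def)
  have le: "S + e \<le> \<theta> * (2 * m)" using m by (auto simp: \<theta>_def max_def field_simps)
  have k: "0 < k" using \<theta> assms by (simp add: k_def)
  have "k * (1 + r\<^sup>2) \<le> qp * r\<^sup>2 - S * r + qm - y * r" if r: "0 \<le> r" and y: "y \<le> e" for r y
  proof -
    have "0 \<le> (sqrt qp * r - sqrt qm)\<^sup>2" by simp
    then have sq: "2 * m * r \<le> qp * r\<^sup>2 + qm"
      using assms by (simp add: power2_diff power_mult_distrib m_def mult_ac)
    have "(S + y) * r \<le> \<theta> * (2 * m) * r"
      using le y r by (intro mult_right_mono) auto
    also have "\<dots> \<le> \<theta> * (qp * r\<^sup>2 + qm)"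
      using mult_left_mono[OF sq \<theta>(1)] by (simp add: mult_ac)
    finally have 1: "(1 - \<theta>) * (qp * r\<^sup>2 + qm) \<le> qp * r\<^sup>2 - S * r + qm - y * r"
      by (simp add: algebra_simps)
    have "min qp qm * (1 + r\<^sup>2) \<le> qp * r\<^sup>2 + qm"
      using mult_right_mono[of "min qp qm" qp "r\<^sup>2"] by (simp add: algebra_simps) 
    from mult_left_mono[OF this, of "1 - \<theta>"] have "k * (1 + r\<^sup>2) \<le> (1 - \<theta>) * (qp * r\<^sup>2 + qm)"
      using \<theta> by (simp add: k_def mult_ac)
    with 1 show ?thesis by simp
  qed
  then show ?thesis using e k unfolding S_def[symmetric] by blast
qed

text \<open>By the mean value theorem the increments of \<open>f\<close> over unit intervals, which tend to \<open>0\<close>, are values of its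
derivative at points \<open>\<xi> n\<close> that go to infinity.\<close>

lemma limit_stationary:
  fixes f F :: "real \<Rightarrow> real"
  assumes mono: "antimono f" and "\<And>x. 0 < x \<Longrightarrow> (f has_real_derivative F x) (at x)"
    and lim: "(\<lambda>n. f (real n)) \<longlonglongrightarrow> L"
    and F: "\<And>\<xi> :: nat \<Rightarrow> real. (\<And>n. real n \<le> \<xi> n) \<Longrightarrow> (\<And>n. \<xi> n \<le> real n + 2) \<Longrightarrow> (\<lambda>n. F (\<xi> n)) \<longlonglongrightarrow> K"
  shows "K = 0"
proof -
  have "\<exists>z. real n < z \<and> z < real n + 2 \<and> f (real (Suc (Suc n))) - f (real (Suc n)) = F z" for n
  proof -
    have "\<exists>z>real (Suc n). z < real (Suc (Suc n)) \<and>
      f (real (Suc (Suc n))) - f (real (Suc n)) = (real (Suc (Suc n)) - real (Suc n)) * F z"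
      by (rule MVT2) (use assms(2) in auto)
    then obtain z where "real (Suc n) < z" "z < real (Suc (Suc n))"
      "f (real (Suc (Suc n))) - f (real (Suc n)) = F z" by auto
    then show ?thesis by (intro exI[of _ z]) auto
  qed
  then obtain \<xi> where \<xi>: "\<And>n. real n < \<xi> n" "\<And>n. \<xi> n < real n + 2"
    "\<And>n. f (real (Suc (Suc n))) - f (real (Suc n)) = F (\<xi> n)" by metis
  have "(\<lambda>n. F (\<xi> n)) \<longlonglongrightarrow> K" by (rule F) (use \<xi> in \<open>auto intro: less_imp_le\<close>)
  moreover have "(\<lambda>n. f (real (Suc (Suc n))) - f (real (Suc n))) \<longlonglongrightarrow> L - L"
    using LIMSEQ_Suc[OF lim] LIMSEQ_Suc[OF LIMSEQ_Suc[OF lim]] by (intro tendsto_diff)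
  ultimately show ?thesis
    unfolding \<xi>(3) using LIMSEQ_unique by fastforce
qed

lemma antimono_squeeze:
  fixes f :: "real \<Rightarrow> real"
  assumes "antimono f" and "(\<lambda>n. f (real n)) \<longlonglongrightarrow> L"
    and "\<And>n. real n \<le> \<xi> n" and "\<And>n. \<xi> n \<le> real n + 2"
  shows "(\<lambda>n. f (\<xi> n)) \<longlonglongrightarrow> L"
proof (rule real_tendsto_sandwich[OF _ _ _ assms(2)])
  have "(\<lambda>n. f (real (Suc (Suc n)))) \<longlonglongrightarrow> L"
    using LIMSEQ_Suc[OF LIMSEQ_Suc[OF assms(2)]] .
  then show "(\<lambda>n. f (real n + 2)) \<longlonglongrightarrow> L" by (simp add: add.commute)
qed (use assms(3,4) antimonoD[OF assms(1)] in \<open>auto intro!: always_eventually\<close>)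

text \<open>The functions \<open>a\<close> and \<open>b\<close> stand for the success probabilities of types \<open>+\<close> and \<open>-\<close> as functions of the starting
point.\<close>

locale monotone_profile =
  fixes qp qm \<beta> :: real and a b :: "real \<Rightarrow> real"
  assumes qp: "0 < qp" and qm: "0 < qm" and \<beta>: "0 < \<beta>"
    and supercritical: "(1/2) * (sqrt qm - sqrt qp)\<^sup>2 < \<beta>"
    and a_deriv: "\<And>x. 0 < x \<Longrightarrow> (a has_real_derivative qp * (a x - b x) - \<beta> * a x * (1 - a x)) (at x)"
    and b_deriv: "\<And>x. 0 < x \<Longrightarrow> (b has_real_derivative qm * (a x - b x) + \<beta> * b x * (1 - b x)) (at x)"
    and a_mono: "antimono a" and b_mono: "antimono b"
    and a_range: "\<And>x. 0 \<le> a x" "\<And>x. a x \<le> 1"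
    and b_range: "\<And>x. 0 < x \<Longrightarrow> 0 < b x" "\<And>x. b x \<le> 1"
begin

text \<open>If \<open>a\<close> vanished somewhere it would vanish from there on, and its equation would force \<open>b\<close> to vanish too.\<close>

lemma a_pos:
  assumes "0 < x" shows "0 < a x"
proof (rule ccontr)
  assume "\<not> 0 < a x"
  then have zero: "a y = 0" if "x \<le> y" for y
    using antimonoD[OF a_mono that] a_range(1)[of y] by simp
  have "\<forall>\<^sub>F y in nhds (x + 1). a y = 0"
    using eventually_nhds_in_open[of "{x<..}" "x + 1"]
    by (rule eventually_mono) (auto intro: zero)
  then have "(a has_real_derivative 0) (at (x + 1))"
    by (subst DERIV_cong_ev[where g = "\<lambda>_. 0"]) auto
  with a_deriv[of "x + 1"] assms have "qp * (a (x + 1) - b (x + 1)) - \<beta> * a (x + 1) * (1 - a (x + 1)) = 0"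
    by (intro DERIV_unique) auto
  then show False using zero[of "x + 1"] qp b_range(1)[of "x + 1"] assms by simp
qed

text \<open>A Riccati equation, perturbed by a term that is small where \<open>a\<close> and \<open>b\<close> are.\<close>

lemma ratio_deriv:
  assumes "0 < x"
  shows "((\<lambda>x. b x / a x) has_real_derivative
    qp * (b x / a x)\<^sup>2 - (qp + qm - 2 * \<beta>) * (b x / a x) + qm - \<beta> * (a x + b x) * (b x / a x)) (at x)"
proof -
  note ax = a_pos[OF assms]
  have "((\<lambda>x. b x / a x) has_real_derivative
    ((qm * (a x - b x) + \<beta> * b x * (1 - b x)) * a x - b x * (qp * (a x - b x) - \<beta> * a x * (1 - a x)))
      / (a x * a x)) (at x)"
    using a_deriv[OF assms] b_deriv[OF assms] ax by (intro DERIV_divide) auto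
  moreover have "((qm * (a x - b x) + \<beta> * b x * (1 - b x)) * a x - b x * (qp * (a x - b x) - \<beta> * a x * (1 - a x)))
      / (a x * a x) = qp * (b x / a x)\<^sup>2 - (qp + qm - 2 * \<beta>) * (b x / a x) + qm - \<beta> * (a x + b x) * (b x / a x)"
    using ax by (simp add: field_simps power2_eq_square)
  ultimately show ?thesis by simp
qed

text \<open>If both functions tended to \<open>0\<close>, then eventually \<open>arctan (b / a)\<close> would have a derivative bounded below by a
positive constant, and could not stay within its range of length \<open>\<pi>\<close>.\<close>

lemma not_small:
  assumes "(\<lambda>n. a (real n)) \<longlonglongrightarrow> 0" "(\<lambda>n. b (real n)) \<longlonglongrightarrow> 0"
  shows False
proof -
  obtain e k where e: "e > 0" and k: "k > 0"
    and bound: "\<And>r y. 0 \<le> r \<Longrightarrow> y \<le> e \<Longrightarrow>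
      k * (1 + r\<^sup>2) \<le> qp * r\<^sup>2 - (qp + qm - 2 * \<beta>) * r + qm - y * r"
    using discriminant_bound[OF qp qm supercritical] by blast
  have "(\<lambda>n. \<beta> * (a (real n) + b (real n))) \<longlonglongrightarrow> \<beta> * (0 + 0)"
    by (intro tendsto_intros assms)
  then have "\<forall>\<^sub>F n in sequentially. \<beta> * (a (real n) + b (real n)) < e"
    using e by (intro order_tendstoD) auto
  then obtain N where N0: "\<forall>n\<ge>N. \<beta> * (a (real n) + b (real n)) < e"
    by (auto simp: eventually_sequentially)
  then have N: "\<beta> * (a (real (Suc N)) + b (real (Suc N))) < e"
    using N0[rule_format, of "Suc N"] by (simp del: of_nat_Suc)
  have small: "\<beta> * (a x + b x) \<le> e" if "real (Suc N) \<le> x" for x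
  proof -
    have "a x + b x \<le> a (real (Suc N)) + b (real (Suc N))"
      using antimonoD[OF a_mono that] antimonoD[OF b_mono that] by (rule add_mono)
    then have "\<beta> * (a x + b x) \<le> \<beta> * (a (real (Suc N)) + b (real (Suc N)))"
      using \<beta> by (intro mult_left_mono) auto
    with N show ?thesis by linarith
  qed
  let ?R = "\<lambda>x. arctan (b x / a x)"
  have R_deriv: "\<exists>D. (?R has_real_derivative D) (at x) \<and> k \<le> D" if x: "real (Suc N) \<le> x" for x
  proof -
    have x0: "0 < x" using x by (simp add: less_le_trans)
    let ?r = "b x / a x"
    let ?D = "qp * ?r\<^sup>2 - (qp + qm - 2 * \<beta>) * ?r + qm - \<beta> * (a x + b x) * ?r"
    have "(?R has_real_derivative inverse (1 + ?r\<^sup>2) * ?D) (at x)"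
      by (rule DERIV_chain2[OF DERIV_arctan ratio_deriv[OF x0]])
    moreover have "k * (1 + ?r\<^sup>2) \<le> ?D"
      using a_pos[OF x0] b_range(1)[OF x0] small[OF x] by (intro bound) auto
    moreover have "0 < 1 + ?r\<^sup>2" by (simp add: add_pos_nonneg)
    ultimately show ?thesis by (auto simp: field_simps)
  qed
  have grow: "?R (real (Suc N)) + k * l \<le> ?R (real (Suc N) + l)" if l: "0 < l" for l
  proof -
    have "(\<lambda>x. ?R x - k * x) (real (Suc N)) \<le> (\<lambda>x. ?R x - k * x) (real (Suc N) + l)"
    proof (rule DERIV_nonneg_imp_nondecreasing[where f = "\<lambda>x. ?R x - k * x"])
      fix x assume "real (Suc N) \<le> x"
      then obtain D where D: "(?R has_real_derivative D) (at x)" "k \<le> D" using R_deriv by blast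
      have "((\<lambda>x. ?R x - k * x) has_real_derivative D - k * 1) (at x)"
        by (intro DERIV_diff D DERIV_cmult DERIV_ident)
      then show "\<exists>y. ((\<lambda>x. ?R x - k * x) has_real_derivative y) (at x) \<and> 0 \<le> y"
        using D(2) by (intro exI[of _ "D - k"]) simp
    qed (use l in simp)
    then show ?thesis by (simp add: algebra_simps)
  qed
  \<comment> \<open>Over a stretch of length \<open>pi / k\<close> the arctangent would gain \<open>pi\<close>.\<close>
  have "k * (pi / k) < pi"
    using grow[of "pi / k"] k arctan_ubound[of "b (real (Suc N) + pi / k) / a (real (Suc N) + pi / k)"]
      arctan_lbound[of "b (real (Suc N)) / a (real (Suc N))"] by simp
  then show False using k by simp
qed

text \<open>The limits of \<open>a\<close> and \<open>b\<close> form a stationary point. The two stationarity conditions give \<open>A - B\<close> weakly opposite signs,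
so \<open>A = B\<close> and \<open>A(1 - A) = 0\<close>. Since the limit \<open>0\<close> is excluded, the decreasing function \<open>a\<close> has the limit \<open>1\<close>.\<close>

theorem constant_one:
  "a x = 1"
proof -
  have conv: "\<exists>L. (\<lambda>n. f (real n)) \<longlonglongrightarrow> L \<and> 0 \<le> L \<and> L \<le> 1 \<and> (\<forall>n. L \<le> f (real n))"
    if f: "antimono f" "\<And>x. 0 < x \<Longrightarrow> 0 \<le> f x" "\<And>x. f x \<le> 1" for f :: "real \<Rightarrow> real"
  proof -
    have dec: "decseq (\<lambda>n. f (real n))" using f(1) by (auto simp: decseq_def antimono_def)
    have "0 \<le> f (real n)" for n
      using f(2)[of "real (Suc n)"] antimonoD[OF f(1), of "real n" "real (Suc n)"] by simp
    then obtain L where L: "(\<lambda>n. f (real n)) \<longlonglongrightarrow> L" "\<And>n. L \<le> f (real n)"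
      using decseq_convergent[OF dec, of 0] by auto
    moreover have "0 \<le> L" using LIMSEQ_le_const[OF L(1), of 0] \<open>\<And>n. 0 \<le> f (real n)\<close> by auto
    moreover have "L \<le> 1" using L(2)[of 0] f(3)[of 0] by simp
    ultimately show ?thesis by blast
  qed
  obtain A where A: "(\<lambda>n. a (real n)) \<longlonglongrightarrow> A" "0 \<le> A" "A \<le> 1" "\<And>n. A \<le> a (real n)"
    using conv[OF a_mono] a_range by blast
  obtain B where B: "(\<lambda>n. b (real n)) \<longlonglongrightarrow> B" "0 \<le> B" "B \<le> 1"
    using conv[OF b_mono] b_range by (meson less_imp_le)
  have eqA: "qp * (A - B) - \<beta> * A * (1 - A) = 0"
    by (rule limit_stationary[OF a_mono a_deriv A(1)])
      (auto intro!: tendsto_intros antimono_squeeze[OF a_mono A(1)] antimono_squeeze[OF b_mono B(1)])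
  have eqB: "qm * (A - B) + \<beta> * B * (1 - B) = 0"
    by (rule limit_stationary[OF b_mono b_deriv B(1)])
      (auto intro!: tendsto_intros antimono_squeeze[OF a_mono A(1)] antimono_squeeze[OF b_mono B(1)])
  have "0 \<le> \<beta> * A * (1 - A)" "0 \<le> \<beta> * B * (1 - B)" using A B \<beta> by auto
  then have "0 \<le> qp * (A - B)" "qm * (A - B) \<le> 0" using eqA eqB by auto
  then have AB: "A = B" using qp qm by (simp add: zero_le_mult_iff mult_le_0_iff)
  then have "A = 0 \<or> A = 1" using eqA \<beta> by simp
  then have "A = 1" using not_small A(1) B(1) AB by blast
  have "A \<le> a (real (nat \<lceil>x\<rceil>))" by (rule A)
  also have "\<dots> \<le> a x" by (rule antimonoD[OF a_mono]) (rule real_nat_ceiling_ge)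
  finally show ?thesis using \<open>A = 1\<close> a_range(2)[of x] by simp
qed

end

section \<open>The branching system\<close>

context branching_rates begin

theorem reach_prob_Plus_supercritical:
  assumes "(1/2) * (sqrt qm - sqrt qp)\<^sup>2 < \<beta>"
  shows "reach_prob Plus x = 1"
proof -
  interpret monotone_profile qp qm \<beta> "reach_prob Plus" "reach_prob Minus"
  proof
    show "(reach_prob Plus has_real_derivative qp * (reach_prob Plus x - reach_prob Minus x) -
        \<beta> * reach_prob Plus x * (1 - reach_prob Plus x)) (at x)" if "0 < x" for x
      using reach_prob_deriv[OF that, of Plus]
      by (rule DERIV_cong) (simp add: first_event_def flip_rate_def power2_eq_square algebra_simps)
    show "(reach_prob Minus has_real_derivative qm * (reach_prob Plus x - reach_prob Minus x) +
        \<beta> * reach_prob Minus x * (1 - reach_prob Minus x)) (at x)" if "0 < x" for x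
      using reach_prob_deriv[OF that, of Minus]
      by (rule DERIV_cong) (simp add: first_event_def flip_rate_def power2_eq_square algebra_simps)
  qed (use qp_pos qm_pos beta_pos assms antimono_reach_prob reach_prob_range reach_prob_Minus_pos
      in \<open>auto intro: less_imp_le\<close>)
  show ?thesis by (rule constant_one)
qed

text \<open>The probabilities computed for the product measure are those of every family of clocks with the
prescribed joint law.\<close>

lemma system_law_unique:
  assumes "branching_clocks qp qm \<beta> M C"
  shows "(\<lambda>\<omega> c. C c \<omega>) \<in> M \<rightarrow>\<^sub>M clock_space"
    and "distr M clock_space (\<lambda>\<omega> c. C c \<omega>) = system_law"
proof -
  interpret prob_space M using assms by (simp add: branching_clocks_def)
  have indep: "indep_vars (\<lambda>_. borel) C UNIV"
    and dist: "\<And>c. distributed M lborel (C c) (exponential_density (clock_rate qp qm \<beta> c))"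
    using assms by (auto simp: branching_clocks_def)
  have rv [measurable]: "C c \<in> borel_measurable M" for c
    using distributed_measurable[OF dist[of c]] by simp
  show "(\<lambda>\<omega> c. C c \<omega>) \<in> M \<rightarrow>\<^sub>M clock_space"
    by (rule measurable_into_clock_space) (rule rv)
  have "distr M borel (C c) = clock_law c" for c
  proof -
    have "distr M borel (C c) = distr M lborel (C c)" by (rule distr_cong) simp_all
    then show ?thesis using distributed_distr_eq_density[OF dist[of c]] by (simp add: clock_law_def)
  qed
  then show "distr M clock_space (\<lambda>\<omega> c. C c \<omega>) = system_law"
    using iffD1[OF indep_vars_iff_distr_eq_PiM[OF _ rv] indep]
    by (simp add: restrict_UNIV system_law_def)
qed

text \<open>Starting from height \<open>K\<close> merely translates the system. If only finitely many particles visited the negative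
half-line, their lifetimes and birth positions would bound how far below \<open>0\<close> any particle gets.\<close>

lemma infinitely_many_negative:
  assumes "regular c" and "\<And>K::nat. \<exists>u. reaches_negative Plus (real K) c u"
  shows "infinite {u. reaches_negative Plus 0 c u}"
proof
  assume fin: "finite {u. reaches_negative Plus 0 c u}"
  have shift: "birth_position Plus x c u = x + birth_position Plus 0 c u" for x u
    by (induction u) auto
  \<comment> \<open>No position of \<open>u\<close> is below \<open>- depth u\<close>.\<close>
  define depth where "depth u = c (Death u) - birth_position Plus 0 c u" for u
  obtain K :: nat where K: "\<And>u. reaches_negative Plus 0 c u \<Longrightarrow> depth u \<le> real K"
  proof -
    have "bdd_above (depth ` {u. reaches_negative Plus 0 c u})" using fin by simp
    then obtain B where "\<And>u. reaches_negative Plus 0 c u \<Longrightarrow> depth u \<le> B" by (auto simp: bdd_above_def)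
    then show ?thesis using that[of "nat \<lceil>B\<rceil>"] real_nat_ceiling_ge[of B] by (meson order.trans)
  qed
  obtain u where u: "reaches_negative Plus (real K) c u" using assms(2) by blast
  then obtain a where a: "0 \<le> a" "a < c (Death u)"
    "real K + birth_position Plus 0 c u + displacement (birth_type Plus c u) (flip_durations c u) a < 0"
    by (auto simp: reaches_negative_iff_age[OF assms(1)] shift[of "real K"])
  have "reaches_negative Plus 0 c u"
    using a by (auto simp: reaches_negative_iff_age[OF assms(1)])
  moreover have "- a \<le> displacement (birth_type Plus c u) (flip_durations c u) a"
    using regularD[OF assms(1)] a(1) by (intro displacement_ge_neg_age) auto
  then have "real K < depth u" using a by (simp add: depth_def)
  ultimately show False using K by force
qed

end

theorem theorem1p1:
  fixes qp qm \<beta> :: real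
    and M :: "'a measure"
    and C :: "clock \<Rightarrow> 'a \<Rightarrow> real"
  assumes "0 < qp" and "qp < qm" and "0 < \<beta>"
    and "branching_clocks qp qm \<beta> M C"
  shows "((1/2) * (sqrt qm - sqrt qp)\<^sup>2 < \<beta> \<longrightarrow>
           (AE \<omega> in M. infinite {u. \<exists>t\<ge>0. alive_at (\<lambda>c. C c \<omega>) u t \<and>
                                       position_at Plus 0 (\<lambda>c. C c \<omega>) u t < 0}))
       \<and> (\<beta> \<le> (1/2) * (sqrt qm - sqrt qp)\<^sup>2 \<longrightarrow>
           measure M {\<omega> \<in> space M. \<forall>t\<ge>0. \<forall>u. alive_at (\<lambda>c. C c \<omega>) u t \<longrightarrow>
                                       \<not> position_at Plus 0 (\<lambda>c. C c \<omega>) u t < 0}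
             \<ge> 1 - sqrt (qp / qm))"
proof -
  interpret branching_rates qp qm \<beta> using assms by unfold_locales auto
  interpret M: prob_space M using assms(4) by (simp add: branching_clocks_def)
  note clocks = system_law_unique[OF assms(4)]
  have transfer: "AE \<omega> in M. P (\<lambda>c. C c \<omega>)" if "AE c in system_law. P c" for P
    using AE_distrD[OF clocks(1)] that unfolding clocks(2) by blast
  have regular_hits: "AE c in system_law. regular c \<and>
      (\<forall>K::nat. (\<exists>n. hits n Plus (real K) c) \<longleftrightarrow> (\<exists>u. reaches_negative Plus (real K) c u))"
    using AE_regular by eventually_elim (simp add: ex_hits_iff_reaches_negative)
  show ?thesis
  proof (intro conjI impI)
    assume super: "(1/2) * (sqrt qm - sqrt qp)\<^sup>2 < \<beta>"
    have "AE c in system_law. \<forall>K::nat. \<exists>n. hits n Plus (real K) c"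
      unfolding AE_all_countable
    proof
      fix K :: nat
      have "system.prob {c. \<exists>n. hits n Plus (real K) c} = 1"
        using reach_prob_Plus_supercritical[OF super] by (simp add: reach_prob_def)
      then show "AE c in system_law. \<exists>n. hits n Plus (real K) c"
        by (auto dest: system.AE_prob_1)
    qed
    with regular_hits have "AE c in system_law. infinite {u. reaches_negative Plus 0 c u}"
      by eventually_elim (rule infinitely_many_negative, blast+)
    from transfer[OF this]
    show "AE \<omega> in M. infinite {u. \<exists>t\<ge>0. alive_at (\<lambda>c. C c \<omega>) u t \<and>
        position_at Plus 0 (\<lambda>c. C c \<omega>) u t < 0}"
      unfolding reaches_negative_def .
  next
    assume sub: "\<beta> \<le> (1/2) * (sqrt qm - sqrt qp)\<^sup>2"
    let ?N = "{c. \<exists>u. reaches_negative Plus 0 c u}"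
    have N: "?N \<in> sets clock_space"
    proof -
      have "Measurable.pred clock_space (\<lambda>c. \<exists>u. reaches_negative Plus 0 c u)" by measurable
      then show ?thesis by (simp add: pred_def space_PiM)
    qed
    have "hit_prob n Plus 0 \<le> sqrt (qp / qm)" for n
      using hit_prob_bound[OF sub, of 0 n Plus] by simp
    then have "reach_prob Plus 0 \<le> sqrt (qp / qm)"
      by (intro LIMSEQ_le_const2[OF hit_prob_tendsto]) auto
    also have "reach_prob Plus 0 = system.prob ?N"
      unfolding reach_prob_def
    proof (rule system.finite_measure_eq_AE)
      show "AE c in system_law. (c \<in> {c. \<exists>n. hits n Plus 0 c}) = (c \<in> ?N)"
        using AE_regular by eventually_elim (simp add: ex_hits_iff_reaches_negative)
    qed (use N sets_ex_hits in auto)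
    also have "\<dots> = measure M {\<omega> \<in> space M. \<exists>u. reaches_negative Plus 0 (\<lambda>c. C c \<omega>) u}"
      unfolding clocks(2)[symmetric] using N clocks(1)
      by (subst measure_distr) (auto simp: vimage_def Int_def conj_commute)
    finally have "1 - sqrt (qp / qm) \<le> 1 - M.prob {\<omega> \<in> space M. \<exists>u. reaches_negative Plus 0 (\<lambda>c. C c \<omega>) u}"
      by simp
    also have "\<dots> = M.prob (space M - {\<omega> \<in> space M. \<exists>u. reaches_negative Plus 0 (\<lambda>c. C c \<omega>) u})"
    proof (rule M.prob_compl[symmetric])
      show "{\<omega> \<in> space M. \<exists>u. reaches_negative Plus 0 (\<lambda>c. C c \<omega>) u} \<in> M.events"
        using measurable_sets[OF clocks(1) N] by (simp add: vimage_def Int_def conj_commute)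
    qed
    also have "space M - {\<omega> \<in> space M. \<exists>u. reaches_negative Plus 0 (\<lambda>c. C c \<omega>) u} =
        {\<omega> \<in> space M. \<forall>t\<ge>0. \<forall>u. alive_at (\<lambda>c. C c \<omega>) u t \<longrightarrow>
          \<not> position_at Plus 0 (\<lambda>c. C c \<omega>) u t < 0}"
      by (auto simp: reaches_negative_def)
    finally show "1 - sqrt (qp / qm) \<le> measure M {\<omega> \<in> space M. \<forall>t\<ge>0. \<forall>u.
        alive_at (\<lambda>c. C c \<omega>) u t \<longrightarrow> \<not> position_at Plus 0 (\<lambda>c. C c \<omega>) u t < 0}" .
  qed
qed

end
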